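(* Let $\nu\in\mathcal A[0,2\pi]$, let $V$ be a nondecreasing real function on $\mathbb R_+$, and let $t_0>0$. Then there exist constants $c>0$ and $A\ge 1$ such that for every subharmonic function $u$ in the complex plane $\mathbb C$ satisfying $$\int_0^{2\pi} u^+(te^{i\theta})\,d\nu(\theta)\le V(t)\qquad \forall t\ge t_0,$$ one has $$u(te^{i\theta})\le c\,V(At)\qquad \forall t\ge t_0,\ \forall\theta\in[0,2\pi].$$ (The constants $c$ and $A$ are independent of $u$.)
   Context: For a real-valued function $h$, $h^+=\max\{h,0\}$. The class $\mathcal A[a,b]$: let $\nu$ be a probability measure on a segment $[a,b]\subset\mathbb R$, identified with its distribution function $\nu(t)=\nu([a,t])$. Suppose $\nu(t)$ is strictly increasing and continuous on $[a,b]$, and let $\mu$ be its inverse function (defined on $[0,1]$), extended to the whole real axis by $\mu(t)=a$ for $t<0$ and $\mu(t)=b$ for $t>1$. Then $\nu\in\mathcal A[a,b]$ means that $$\lim_{\delta\to0}\ \sup_{x\in\mathbb R}\int_0^\delta\frac{\mu(x+t)-\mu(x-t)}{t}\,dt=0.$$ *)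

theory Defs
  imports "HOL-Probability.Probability"
begin

definition usc_on :: "'a::topological_space set \<Rightarrow> ('a \<Rightarrow> ereal) \<Rightarrow> bool" where
  "usc_on S u \<longleftrightarrow> (\<forall>z\<in>S. \<forall>\<alpha>>u z. \<forall>\<^sub>F w in at z within S. u w < \<alpha>)"

text \<open>Lebesgue integral of an extended real function whose positive part is integrable;
  the value is \<open>-\<infinity>\<close> if the negative part is not.  (\<open>e2ennreal\<close> sends negative arguments to 0.)\<close>

definition ereal_integral :: "'a measure \<Rightarrow> ('a \<Rightarrow> ereal) \<Rightarrow> ereal" where
  "ereal_integral M f =
     enn2ereal (\<integral>\<^sup>+x. e2ennreal (f x) \<partial>M) - enn2ereal (\<integral>\<^sup>+x. e2ennreal (- f x) \<partial>M)"

text \<open>The function that is identically \<open>-\<infinity>\<close> is admitted as subharmonic.  By upper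
  semicontinuity \<open>u\<close> is Borel and bounded above on every circle in \<open>S\<close>, so the integral in the
  mean value inequality is of the form handled by \<open>ereal_integral\<close>.\<close>

definition subharmonic_on :: "complex set \<Rightarrow> (complex \<Rightarrow> ereal) \<Rightarrow> bool" where
  "subharmonic_on S u \<longleftrightarrow>
     open S \<and> (\<forall>z\<in>S. u z < \<infinity>) \<and> usc_on S u \<and>
     (\<forall>z r. 0 < r \<longrightarrow> cball z r \<subseteq> S \<longrightarrow>
        u z \<le> ereal_integral (restrict_space lborel {0..2 * pi}) (\<lambda>\<theta>. u (z + rcis r \<theta>))
               / ereal (2 * pi))"

definition distr_fun :: "real measure \<Rightarrow> real \<Rightarrow> real \<Rightarrow> real" where
  "distr_fun \<nu> a t = measure \<nu> {a..t}"

definition distr_inv :: "real measure \<Rightarrow> real \<Rightarrow> real \<Rightarrow> real \<Rightarrow> real" where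
  "distr_inv \<nu> a b t =
     (if t < 0 then a else if t > 1 then b else the_inv_into {a..b} (distr_fun \<nu> a) t)"

text \<open>The inverse of the distribution function has to be defined on all of \<open>[0,1]\<close>; given strict
  monotonicity and continuity, the condition on the image below says exactly that \<open>\<nu>\<close> has no
  atom at \<open>a\<close>.  The integrand is nonnegative because the inverse is nondecreasing, so the integral
  is taken in \<open>[0,\<infinity>]\<close>.\<close>

definition class_A :: "real \<Rightarrow> real \<Rightarrow> real measure set" where
  "class_A a b = {\<nu>.
     prob_space \<nu> \<and> sets \<nu> = sets (restrict_space borel {a..b}) \<and>
     strict_mono_on {a..b} (distr_fun \<nu> a) \<and> continuous_on {a..b} (distr_fun \<nu> a) \<and>
     distr_fun \<nu> a ` {a..b} = {0..1} \<and>
     ((\<lambda>\<delta>. SUP x. \<integral>\<^sup>+t\<in>{0<..\<delta>}.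
          ennreal ((distr_inv \<nu> a b (x + t) - distr_inv \<nu> a b (x - t)) / t) \<partial>lborel)
        \<longlongrightarrow> 0) (at_right 0)}"

end

theory Submission
  imports Defs "HOL-Complex_Analysis.Complex_Analysis"
begin

text \<open>Let \<open>\<mu>\<close> be the inverse of the distribution function of \<open>\<nu>\<close>, and suppose for a moment that
\<open>f\<close> is a holomorphic function on the unit disc with \<open>f 0 = 0\<close> and with
\<open>arg (f (exp (2 \<pi> i x))) = \<mu> x\<close> on the circle.  Since \<open>\<mu>\<close> carries Lebesgue measure on \<open>[0,1]\<close> to
\<open>\<nu>\<close>, the mean value inequality for \<open>z \<mapsto> u (s f z)\<close> bounds \<open>u 0\<close> by the integral of
\<open>u (s R(\<theta>) exp (i \<theta>))\<close> against \<open>\<nu>\<close>, where \<open>R\<close> is the boundary modulus of \<open>f\<close>.  If \<open>R\<close> lies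
between two positive constants, then integrating over \<open>s \<in> [S, 2S]\<close> replaces the curve
\<open>s R(\<theta>) exp (i \<theta>)\<close> by whole segments of each ray, and Fubini's theorem turns the right-hand side
into integrals over circles, which the hypothesis controls.  The Poisson kernel is at most 5
on \<open>\<bar>z\<bar> \<le> 2/3\<close>, so the same bound holds (up to a constant) at every point of the image of
\<open>\<bar>z\<bar> < 1/2\<close>; this image contains a disc around 0, and taking \<open>S\<close> proportional to \<open>t\<close> brings
every point of the circle of radius \<open>t\<close> into \<open>s f\<close> of that disc.

Such an \<open>f\<close> is explicit: \<open>f z = z exp (g z)\<close>, where \<open>g\<close> is \<open>i\<close> times the Schwarz integral of the
periodic function \<open>\<mu> x - 2 \<pi> x\<close>.  The real part of \<open>g\<close>, that is \<open>log \<bar>f z / z\<bar>\<close>, is given by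
the conjugate Poisson kernel, which is at most a constant over \<open>t\<close>; hence it is bounded by the
integrals of \<open>(\<mu> (x + t) - \<mu> (x - t)) / t\<close>, and the condition defining the class \<open>\<A>\<close> makes them
bounded uniformly in \<open>x\<close> (lemma \<open>conjugate_bounded\<close>).

Two points need care.  The bounds for \<open>\<bar>f z / z\<bar>\<close> hold inside the disc, so the estimate is made
on circles of radius \<open>\<rho> < 1\<close>, and as \<open>\<rho> \<rightarrow> 1\<close> it suffices that the argument converges.  The limit is taken after the integration in \<open>s\<close>, by the reverse Fatou lemma, because
the integral of an upper semicontinuous function along a ray is upper semicontinuous in the
angle (\<open>radial_int_usc\<close>, \<open>radial_mean_bound\<close>).  The bound of \<open>u \<circ> f\<close> by its Poisson integral comes
from a maximum principle (\<open>comp_maximum_principle\<close>), for which \<open>f\<close> should be locally injective.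
This holds because \<open>arg f\<close> increases along every circle \<open>\<bar>z\<bar> = \<rho>\<close>, the function \<open>\<mu>\<close> being
increasing, so that \<open>Re (z f' z / f z) \<ge> 0\<close> and, by the open mapping theorem, \<open>f'\<close> has no zero
(\<open>starlike_deriv_nz\<close>).\<close>

section \<open>Schwarz and Poisson integrals on the unit circle\<close>

definition circ :: "real \<Rightarrow> complex" where "circ x = cis (2 * pi * x)"

lemma norm_circ [simp]: "norm (circ x) = 1"
  by (simp add: circ_def)

lemma circ_nz [simp]: "circ x \<noteq> 0"
  by (metis norm_circ norm_zero zero_neq_one)

lemma circ_ne: "norm w < 1 \<Longrightarrow> circ x - w \<noteq> 0"
  by (metis norm_circ eq_iff_diff_eq_0 less_irrefl)

lemma circ_add: "circ (x + y) = circ x * circ y"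
  by (simp add: circ_def cis_mult algebra_simps)

lemma circ_1 [simp]: "circ 1 = 1" and circ_0 [simp]: "circ 0 = 1"
  by (simp_all add: circ_def)

lemma continuous_on_circ [continuous_intros]: "continuous_on S circ"
  unfolding circ_def by (intro continuous_intros)

lemma circ_exp: "circ x = exp (2 * of_real pi * \<i> * of_real x)"
  by (simp add: circ_def cis_conv_exp mult_ac)

text \<open>Its real part is the Poisson kernel, its imaginary part the conjugate Poisson kernel.\<close>

definition schwarz_kernel :: "complex \<Rightarrow> real \<Rightarrow> complex" where
  "schwarz_kernel w x = (circ x + w) / (circ x - w)"

definition schwarz_int :: "(real \<Rightarrow> real) \<Rightarrow> complex \<Rightarrow> complex" where
  "schwarz_int \<psi> w = integral {0..1} (\<lambda>x. schwarz_kernel w x * of_real (\<psi> x))"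

lemma continuous_on_schwarz_kernel:
  "norm w < 1 \<Longrightarrow> continuous_on S (schwarz_kernel w)"
  unfolding schwarz_kernel_def using circ_ne by (intro continuous_intros) auto

lemma Re_schwarz_kernel:
  "norm w < 1 \<Longrightarrow> Re (schwarz_kernel w x) = (1 - (norm w)\<^sup>2) / (norm (circ x - w))\<^sup>2"
proof -
  have *: "Re ((a + w) / (a - w)) = ((norm a)\<^sup>2 - (norm w)\<^sup>2) / (norm (a - w))\<^sup>2" for a
    unfolding Re_divide cmod_power2 by (simp add: algebra_simps power2_eq_square)
  show "norm w < 1 \<Longrightarrow> ?thesis"
    by (simp add: schwarz_kernel_def *)
qed

lemma Re_schwarz_kernel_nonneg: "norm w < 1 \<Longrightarrow> Re (schwarz_kernel w x) \<ge> 0"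
  by (simp add: Re_schwarz_kernel power_le_one)

lemma schwarz_int_integrable:
  assumes "norm w < 1" "continuous_on {0..1} \<psi>"
  shows "(\<lambda>x. schwarz_kernel w x * of_real (\<psi> x)) integrable_on {0..1}"
  by (intro integrable_continuous_real continuous_intros continuous_on_schwarz_kernel assms)

lemma Re_schwarz_int:
  assumes "norm w < 1" "continuous_on {0..1} \<psi>"
  shows "Re (schwarz_int \<psi> w) = integral {0..1} (\<lambda>x. Re (schwarz_kernel w x) * \<psi> x)"
  using integral_linear[OF schwarz_int_integrable[OF assms] bounded_linear_Re]
  by (simp add: schwarz_int_def o_def)

lemma schwarz_int_holomorphic:
  assumes "continuous_on {0..1} \<psi>"
  shows "schwarz_int \<psi> holomorphic_on ball 0 1"
proof -
  have "(\<lambda>w. integral (cbox 0 1) (\<lambda>x. schwarz_kernel w x * of_real (\<psi> x))) holomorphic_on ball 0 1"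
  proof (rule leibniz_rule_holomorphic)
    fix w x assume w: "w \<in> ball (0::complex) 1" and x: "x \<in> cbox (0::real) 1"
    have "circ x - w \<noteq> 0" using w by (intro circ_ne) auto
    then show "((\<lambda>w. schwarz_kernel w x * of_real (\<psi> x)) has_field_derivative
         (2 * circ x / (circ x - w)\<^sup>2) * of_real (\<psi> x)) (at w within ball 0 1)"
      unfolding schwarz_kernel_def
      by (auto intro!: derivative_eq_intros simp: field_simps power2_eq_square)
  next
    fix w assume "w \<in> ball (0::complex) 1"
    then show "(\<lambda>x. schwarz_kernel w x * of_real (\<psi> x)) integrable_on cbox 0 1"
      using schwarz_int_integrable assms by simp
  next
    have "continuous_on (ball 0 1 \<times> cbox 0 1) (\<lambda>p::complex\<times>real. \<psi> (snd p))"
      by (rule continuous_on_compose2[OF assms]) (auto intro!: continuous_intros)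
    moreover have "continuous_on (ball 0 1 \<times> cbox 0 1) (\<lambda>p::complex\<times>real. circ (snd p))"
      by (rule continuous_on_compose2[OF continuous_on_circ]) (auto intro!: continuous_intros)
    ultimately show "continuous_on (ball 0 1 \<times> cbox 0 1)
        (\<lambda>(w, x). (2 * circ x / (circ x - w)\<^sup>2) * of_real (\<psi> x))"
      unfolding case_prod_unfold
      by (intro continuous_intros) (use circ_ne in auto)
  qed simp
  then show ?thesis by (simp add: schwarz_int_def [abs_def])
qed

text \<open>With \<open>u = z0 + r circ x\<close> one has \<open>du = 2 \<pi> i r circ x dx\<close>; this converts contour integrals into integrals
over \<open>x \<in> [0,1]\<close>.\<close>

lemma circlepath_has_integral:
  assumes "(k has_contour_integral 2 * of_real pi * \<i> * of_real r * I) (circlepath z0 r)" "r > 0"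
  shows "((\<lambda>x. k (z0 + of_real r * circ x) * circ x) has_integral I) {0..1}"
proof -
  let ?c = "2 * of_real pi * \<i> * of_real r"
  have "((\<lambda>x. ?c * (k (z0 + of_real r * circ x) * circ x)) has_integral ?c * I) {0..1}"
    using assms(1) unfolding has_contour_integral_def
  proof (rule has_integral_eq[rotated])
    fix x :: real assume x: "x \<in> {0..1}"
    have "circlepath z0 r x = z0 + of_real r * circ x" by (simp add: circlepath circ_exp)
    with x show "k (circlepath z0 r x) * vector_derivative (circlepath z0 r) (at x within {0..1})
        = ?c * (k (z0 + of_real r * circ x) * circ x)"
      by (simp add: vector_derivative_circlepath01 circ_exp)
  qed
  from has_integral_mult_right[OF this, of "inverse ?c"] show ?thesis
    using \<open>r > 0\<close> by (simp add: field_simps)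
qed

text \<open>The kernel times \<open>du / u\<close> has the partial fractions \<open>2 / (u - w) - 1 / u\<close>, and both poles lie
inside the circle.\<close>

lemma schwarz_int_const:
  assumes "norm w < 1"
  shows "schwarz_int (\<lambda>_. 1) w = 1"
proof -
  have "((\<lambda>u. 1 / (u - a)) has_contour_integral (2 * of_real pi * \<i> * 1)) (circlepath 0 1)"
    if "norm a < 1" for a
    by (rule Cauchy_integral_circlepath_simple) (use that in auto)
  from has_contour_integral_diff[OF has_contour_integral_lmul[OF this[OF assms], of 2] this[of 0]]
  have "((\<lambda>u. 2 * (1 / (u - w)) - 1 / u) has_contour_integral
           (2 * of_real pi * \<i> * of_real 1 * 1)) (circlepath 0 1)"
    by (simp add: mult_ac)
  from circlepath_has_integral[OF this]
  have "((\<lambda>x. (2 * (1 / (circ x - w)) - 1 / circ x) * circ x) has_integral 1) {0..1}" by simp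
  moreover have "(2 * (1 / (circ x - w)) - 1 / circ x) * circ x = schwarz_kernel w x" for x
    using circ_ne[OF assms, of x] by (simp add: schwarz_kernel_def field_simps)
  ultimately have "(schwarz_kernel w has_integral 1) {0..1}" by (simp only:)
  then show ?thesis by (simp add: schwarz_int_def integral_unique)
qed

lemma poisson_total:
  assumes "norm w < 1"
  shows "integral {0..1} (\<lambda>x. Re (schwarz_kernel w x)) = 1"
  using Re_schwarz_int[OF assms, of "\<lambda>_. 1"] schwarz_int_const[OF assms] by simp

text \<open>Continuity at \<open>y\<close> is measured along the circle, so that the endpoints 0 and 1 are identified.
Instead of cutting the integral at a distance \<open>\<delta>\<close> from \<open>y\<close>, the oscillation of \<open>\<psi>\<close> is bounded by
\<open>\<epsilon>/2 + C \<bar>circ x - circ y\<bar>\<^sup>2\<close> everywhere.  The Poisson kernel times \<open>\<bar>circ x - w\<bar>\<^sup>2\<close> is the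
constant \<open>1 - \<bar>w\<bar>\<^sup>2\<close>, which makes the integral of the quadratic term tend to 0.\<close>

lemma poisson_boundary_limit:
  assumes cont: "continuous_on {0..1} \<psi>" and y: "y \<in> {0..1}"
    and at_y: "\<And>\<epsilon>. \<epsilon> > 0 \<Longrightarrow> \<exists>\<delta>>0. \<forall>x\<in>{0..1}. norm (circ x - circ y) < \<delta> \<longrightarrow> \<bar>\<psi> x - \<psi> y\<bar> < \<epsilon>"
  shows "((\<lambda>w. Re (schwarz_int \<psi> w)) \<longlongrightarrow> \<psi> y) (at (circ y) within ball 0 1)"
proof (rule tendstoI)
  fix \<epsilon> :: real assume "\<epsilon> > 0"
  then obtain \<delta> where \<delta>: "\<delta> > 0" "\<And>x. x \<in> {0..1} \<Longrightarrow> norm (circ x - circ y) < \<delta> \<Longrightarrow> \<bar>\<psi> x - \<psi> y\<bar> < \<epsilon>/2"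
    using at_y[of "\<epsilon>/2"] by auto
  obtain M where M: "M > 0" "\<And>x. x \<in> {0..1} \<Longrightarrow> \<bar>\<psi> x\<bar> \<le> M"
    using compact_imp_bounded[OF compact_continuous_image[OF cont compact_Icc]]
    unfolding bounded_pos by auto
  define C where "C = 2 * M / \<delta>\<^sup>2"
  have C: "C > 0" using M \<delta> by (simp add: C_def)
  have bd: "\<bar>\<psi> x - \<psi> y\<bar> \<le> \<epsilon>/2 + C * (norm (circ x - circ y))\<^sup>2" if "x \<in> {0..1}" for x
  proof (cases "norm (circ x - circ y) < \<delta>")
    case True
    have "0 \<le> C * (norm (circ x - circ y))\<^sup>2" using C by simp
    then show ?thesis using \<delta>(2)[OF that True] by linarith
  next
    case False
    then have "\<delta>\<^sup>2 \<le> (norm (circ x - circ y))\<^sup>2" using \<delta> by (intro power_mono) auto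
    then have "C * \<delta>\<^sup>2 \<le> C * (norm (circ x - circ y))\<^sup>2" using C by simp
    moreover have "C * \<delta>\<^sup>2 = 2 * M" using \<delta> by (simp add: C_def)
    ultimately show ?thesis using M(2)[OF that] M(2)[OF y] \<open>\<epsilon> > 0\<close> by auto
  qed
  have key: "\<bar>Re (schwarz_int \<psi> w) - \<psi> y\<bar> \<le> \<epsilon>/2 + 2 * C * ((1 - (norm w)\<^sup>2) + (norm (w - circ y))\<^sup>2)"
    if w: "norm w < 1" for w
  proof -
    let ?P = "\<lambda>x. Re (schwarz_kernel w x)"
    have contP: "continuous_on {0..1} ?P"
      by (intro continuous_intros continuous_on_schwarz_kernel w)
    have "Re (schwarz_int \<psi> w) - \<psi> y = integral {0..1} (\<lambda>x. ?P x * \<psi> x) - integral {0..1} ?P * \<psi> y"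
      using Re_schwarz_int[OF w cont] poisson_total[OF w] by simp
    also have "\<dots> = integral {0..1} (\<lambda>x. ?P x * (\<psi> x - \<psi> y))"
      by (simp add: right_diff_distrib integral_diff integrable_continuous_real contP cont
            continuous_on_mult flip: integral_mult_left)
    also have "\<bar>\<dots>\<bar> \<le> integral {0..1} (\<lambda>x. ?P x * (\<epsilon>/2 + 2 * C * (norm (w - circ y))\<^sup>2) + 2 * C * (1 - (norm w)\<^sup>2))"
      unfolding real_norm_def [symmetric]
    proof (rule integral_norm_bound_integral)
      fix x :: real assume x: "x \<in> {0..1}"
      have P0: "?P x \<ge> 0" using Re_schwarz_kernel_nonneg[OF w] .
      have "norm (circ x - circ y) \<le> norm (circ x - w) + norm (w - circ y)"
        using norm_triangle_ineq[of "circ x - w" "w - circ y"] by simp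
      then have "(norm (circ x - circ y))\<^sup>2 \<le> (norm (circ x - w) + norm (w - circ y))\<^sup>2"
        by (intro power_mono) auto
      also have "\<dots> \<le> 2 * (norm (circ x - w))\<^sup>2 + 2 * (norm (w - circ y))\<^sup>2"
        using sum_squares_bound[of "norm (circ x - w)" "norm (w - circ y)"] by (simp add: power2_sum)
      finally have n: "(norm (circ x - circ y))\<^sup>2 \<le> 2 * (norm (circ x - w))\<^sup>2 + 2 * (norm (w - circ y))\<^sup>2" .
      have "\<bar>?P x * (\<psi> x - \<psi> y)\<bar> = ?P x * \<bar>\<psi> x - \<psi> y\<bar>" using P0 by (simp add: abs_mult)
      also have "\<dots> \<le> ?P x * (\<epsilon>/2 + C * (2 * (norm (circ x - w))\<^sup>2 + 2 * (norm (w - circ y))\<^sup>2))"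
        using bd[OF x] mult_left_mono[OF n, of C] C P0 by (intro mult_left_mono) linarith+
      also have "\<dots> = ?P x * (\<epsilon>/2 + 2 * C * (norm (w - circ y))\<^sup>2) + 2 * C * (?P x * (norm (circ x - w))\<^sup>2)"
        by (simp add: algebra_simps)
      also have "?P x * (norm (circ x - w))\<^sup>2 = 1 - (norm w)\<^sup>2"
        using circ_ne[OF w, of x] by (simp add: Re_schwarz_kernel[OF w])
      finally show "norm (?P x * (\<psi> x - \<psi> y)) \<le> ?P x * (\<epsilon>/2 + 2 * C * (norm (w - circ y))\<^sup>2) + 2 * C * (1 - (norm w)\<^sup>2)"
        by simp
    qed (auto intro!: integrable_continuous_real continuous_intros contP cont)
    also have "\<dots> = (\<epsilon>/2 + 2 * C * (norm (w - circ y))\<^sup>2) + 2 * C * (1 - (norm w)\<^sup>2)"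
      by (subst integral_add) (auto intro!: integrable_continuous_real continuous_intros contP simp: poisson_total[OF w])
    finally show ?thesis by (simp add: algebra_simps)
  qed
  have "((\<lambda>w. \<epsilon>/2 + 2 * C * ((1 - (norm w)\<^sup>2) + (norm (w - circ y))\<^sup>2)) \<longlongrightarrow>
      \<epsilon>/2 + 2 * C * ((1 - (norm (circ y))\<^sup>2) + (norm (circ y - circ y))\<^sup>2)) (at (circ y) within ball 0 1)"
    by (intro tendsto_intros)
  then have "eventually (\<lambda>w. \<epsilon>/2 + 2 * C * ((1 - (norm w)\<^sup>2) + (norm (w - circ y))\<^sup>2) < \<epsilon>) (at (circ y) within ball 0 1)"
    by (rule order_tendstoD(2)) (use \<open>\<epsilon> > 0\<close> in auto)
  moreover have "eventually (\<lambda>w. w \<in> ball 0 1) (at (circ y) within ball (0::complex) 1)"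
    by (simp add: eventually_at_filter)
  ultimately show "eventually (\<lambda>w. dist (Re (schwarz_int \<psi> w)) (\<psi> y) < \<epsilon>) (at (circ y) within ball 0 1)"
    by eventually_elim (use key in \<open>fastforce simp: dist_real_def\<close>)
qed

lemma circ_surj:
  assumes "norm \<zeta> = 1" obtains y where "y \<in> {0..<1}" "\<zeta> = circ y"
proof
  show "Arg2pi \<zeta> / (2*pi) \<in> {0..<1}" using Arg2pi[of \<zeta>] by (auto simp: field_simps)
  show "\<zeta> = circ (Arg2pi \<zeta> / (2*pi))"
    using complex_norm_eq_1_exp assms by (simp add: circ_def cis_conv_exp)
qed

lemma polar_circ:
  obtains \<rho> y where "0 \<le> \<rho>" "\<rho> = norm w" "y \<in> {0..<1}" "w = of_real \<rho> * circ y"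
proof (cases "w = 0")
  case True
  then show ?thesis using that[of 0 0] by simp
next
  case False
  then have "norm (sgn w) = 1" by (simp add: norm_sgn)
  then obtain y where y: "y \<in> {0..<1}" "sgn w = circ y" by (rule circ_surj)
  have "w = of_real (norm w) * circ y" 
    using False y(2) by (simp add: sgn_eq field_simps)
  then show ?thesis using that[of "norm w" y] y by simp
qed

section \<open>A maximum principle for compositions with locally injective maps\<close>

definition usc_real :: "('a::topological_space \<Rightarrow> real) \<Rightarrow> bool" where
  "usc_real w \<longleftrightarrow> (\<forall>c. open {z. w z < c})"

text \<open>The mean value inequality is stated through integrable majorants \<open>c\<close> of \<open>w\<close> on the circle, so
that it makes sense without measurability of \<open>w\<close> and can be combined directly with the strict
estimates on arcs in the maximum principle.\<close>

definition submean :: "(complex \<Rightarrow> real) \<Rightarrow> bool" where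
  "submean w \<longleftrightarrow> (\<forall>z r c. 0 < r \<longrightarrow> set_integrable lborel {0..1} c \<longrightarrow>
     (\<forall>x\<in>{0..1}. w (z + of_real r * circ x) \<le> c x) \<longrightarrow> w z \<le> (LINT x:{0..1}|lborel. c x))"

lemma usc_real_measurable [measurable_dest]:
  "usc_real w \<Longrightarrow> w \<in> borel_measurable borel"
  unfolding usc_real_def by (subst borel_measurable_iff_less) auto

lemma usc_attains_sup:
  fixes q :: "'a::topological_space \<Rightarrow> real"
  assumes "compact K" "K \<noteq> {}"
    and usc: "\<And>c. openin (top_of_set K) {z\<in>K. q z < c}"
  obtains y where "y \<in> K" "\<And>z. z \<in> K \<Longrightarrow> q z \<le> q y"
proof (rule ccontr)
  assume "\<not> thesis"
  then have no: "\<And>y. y \<in> K \<Longrightarrow> \<exists>z\<in>K. q y < q z" using that by force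
  have "\<exists>T. open T \<and> {z\<in>K. q z < q y} = K \<inter> T" for y
    using usc[of "q y"] unfolding openin_open by auto
  then obtain T where T: "\<And>y. open (T y)" "\<And>y. {z\<in>K. q z < q y} = K \<inter> T y" by metis
  have "K \<subseteq> \<Union> (T ` K)" using no T(2) by blast
  then obtain C where C: "C \<subseteq> K" "finite C" "K \<subseteq> \<Union> (T ` C)"
    using compactE_image[OF \<open>compact K\<close>, of K T] T(1) by blast
  have "C \<noteq> {}" using C \<open>K \<noteq> {}\<close> by auto
  then obtain y where y: "y \<in> C" "\<And>z. z \<in> C \<Longrightarrow> q z \<le> q y"
  proof -
    have "Max (q ` C) \<in> q ` C" using C(2) \<open>C \<noteq> {}\<close> by (intro Max_in) auto
    then obtain y where "y \<in> C" "Max (q ` C) = q y" by blast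
    moreover have "q z \<le> Max (q ` C)" if "z \<in> C" for z using that C(2) by (intro Max_ge) auto
    ultimately show ?thesis using that by auto
  qed
  then obtain z where "z \<in> C" "y \<in> T z" using C by blast
  then have "q y < q z" using T(2)[of z] y C by auto
  then show False using y(2)[OF \<open>z \<in> C\<close>] by simp
qed

lemma mean_value_circle:
  assumes "k holomorphic_on V" "open V" "cball z0 r \<subseteq> V" "0 < r"
  shows "((\<lambda>x. k (z0 + of_real r * circ x)) has_integral k z0) {0..1}"
proof -
  have "((\<lambda>u. k u / (u - z0)) has_contour_integral (2 * of_real pi * \<i> * k z0)) (circlepath z0 r)"
    by (rule Cauchy_integral_circlepath_simple) (use assms in \<open>auto intro: holomorphic_on_subset\<close>)
  then have "((\<lambda>u. k u / (u - z0)) has_contour_integral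
      (2 * of_real pi * \<i> * of_real r * (k z0 / of_real r))) (circlepath z0 r)"
    using \<open>0 < r\<close> by (simp add: mult_ac)
  from has_integral_mult_right[OF circlepath_has_integral[OF this \<open>0 < r\<close>], of "of_real r"]
  show ?thesis using \<open>0 < r\<close> by simp
qed

text \<open>The usual argument that the set of maximum points is open: if the value at \<open>z1\<close> were smaller
than \<open>M\<close>, then by semicontinuity the difference would stay below \<open>M - \<eta>\<close> on an arc of the circle
through \<open>z1\<close> around \<open>z0\<close>, and the mean over this circle would be smaller than the value at \<open>z0\<close>.\<close>

lemma submean_max_on_circles:
  assumes w: "usc_real w" "submean w"
    and k: "k holomorphic_on V" "open V" "cball z0 R \<subseteq> V"
    and le: "\<And>z. z \<in> V \<Longrightarrow> w z - Re (k z) \<le> M" and eq: "w z0 - Re (k z0) = M"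
    and z1: "z1 \<in> cball z0 R"
  shows "w z1 - Re (k z1) = M"
proof (rule ccontr)
  assume ne: "w z1 - Re (k z1) \<noteq> M"
  have z1V: "z1 \<in> V" using z1 k by auto
  define \<rho> where "\<rho> = norm (z1 - z0)"
  have "\<rho> > 0" using ne eq by (auto simp: \<rho>_def)
  have cb: "cball z0 \<rho> \<subseteq> V" using z1 k by (force simp: \<rho>_def dist_norm norm_minus_commute)
  obtain y where y: "y \<in> {0..<1}" "(z1 - z0) / of_real \<rho> = circ y"
    using circ_surj[of "(z1 - z0) / of_real \<rho>"] \<open>\<rho> > 0\<close> by (auto simp: \<rho>_def norm_divide)
  then have z1e: "z1 = z0 + of_real \<rho> * circ y" using \<open>\<rho> > 0\<close> by (simp add: field_simps)
  define \<eta> where "\<eta> = (M + Re (k z1) - w z1) / 3"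
  have "\<eta> > 0" using ne le[OF z1V] by (simp add: \<eta>_def)
  let ?p = "\<lambda>x. z0 + of_real \<rho> * circ x"
  have pV: "?p x \<in> V" for x using cb \<open>\<rho> > 0\<close> by (auto simp: dist_norm norm_mult)
  have contk: "continuous_on UNIV (\<lambda>x. Re (k (?p x)))"
    by (intro continuous_intros continuous_on_compose2[OF holomorphic_on_imp_continuous_on[OF k(1)]])
       (use pV in auto)
  have "continuous_on UNIV ?p" by (intro continuous_intros)
  from continuous_open_preimage[OF this open_UNIV, of "{z. w z < w z1 + \<eta>}"]
  have "open {x. w (?p x) < w z1 + \<eta>}"
    using w(1) by (simp add: usc_real_def vimage_def)
  moreover have "open {x. Re (k z1) - \<eta> < Re (k (?p x))}"
    using contk by (intro open_Collect_less) (auto intro!: continuous_intros)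
  ultimately have "open ({x. w (?p x) < w z1 + \<eta>} \<inter> {x. Re (k z1) - \<eta> < Re (k (?p x))})" by blast
  moreover have "y \<in> {x. w (?p x) < w z1 + \<eta>} \<inter> {x. Re (k z1) - \<eta> < Re (k (?p x))}"
    using z1e \<open>\<eta> > 0\<close> by auto
  ultimately obtain d where d: "d > 0" "ball y d \<subseteq> {x. w (?p x) < w z1 + \<eta>} \<inter> {x. Re (k z1) - \<eta> < Re (k (?p x))}"
    using open_contains_ball by meson
  \<comment> \<open>the arc starts at \<open>y\<close> and is cut off at 1, to stay inside \<open>[0,1]\<close>\<close>
  define d' where "d' = min (d/2) (1 - y)"
  have d': "d' > 0" using d y by (auto simp: d'_def)
  define J where "J = {y..y+d'}"
  have J: "J \<subseteq> {0..1}" using y by (auto simp: J_def d'_def)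
  have Jb: "J \<subseteq> ball y d" using d(1) by (auto simp: J_def d'_def dist_real_def)
  let ?b = "\<lambda>x. M + Re (k (?p x))"
  have intb: "set_integrable lborel {0..1} ?b"
    by (rule borel_integrable_atLeastAtMost') (auto intro!: continuous_intros continuous_on_subset[OF contk])
  have intJ: "set_integrable lborel {0..1} (\<lambda>x. \<eta> * indicator J x)"
  proof -
    have "(\<lambda>x. indicator {0..1} x *\<^sub>R (\<eta> * indicator J x)) = (\<lambda>x::real. \<eta> * indicator J x)"
      using J by (auto simp: indicator_def fun_eq_iff)
    moreover have "integrable lborel (\<lambda>x::real. \<eta> * indicator J x)"
      by (intro integrable_mult_right integrable_real_indicator) (simp_all add: J_def emeasure_lborel_Icc_eq)
    ultimately show ?thesis by (simp add: set_integrable_def)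
  qed
  have "w z0 \<le> (LINT x:{0..1}|lborel. ?b x - \<eta> * indicator J x)"
  proof -
    have "w (?p x) \<le> ?b x - \<eta> * indicator J x" if "x \<in> {0..1}" for x
    proof (cases "x \<in> J")
      case True
      then have "w (?p x) < w z1 + \<eta>" "Re (k z1) - \<eta> < Re (k (?p x))" using Jb d(2) by blast+
      moreover have "w z1 = M + Re (k z1) - 3 * \<eta>" by (simp add: \<eta>_def field_simps)
      ultimately show ?thesis using True by simp
    next
      case False then show ?thesis using le[OF pV, of x] by simp
    qed
    then show ?thesis using w(2) \<open>\<rho> > 0\<close> set_integral_diff(1)[OF intb intJ]
      unfolding submean_def by blast
  qed
  also have "\<dots> = (LINT x:{0..1}|lborel. ?b x) - (LINT x:{0..1}|lborel. \<eta> * indicator J x)"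
    by (rule set_integral_diff(2)[OF intb intJ])
  also have "(LINT x:{0..1}|lborel. ?b x) = M + Re (k z0)"
  proof -
    have "(LINT x:{0..1}|lborel. ?b x) = integral {0..1} ?b"
      by (rule set_borel_integral_eq_integral(2)[OF intb])
    also have "(?b has_integral (M + Re (k z0))) {0..1}"
      using has_integral_add[OF has_integral_const_real[of M 0 1]
         has_integral_Re[OF mean_value_circle[OF k(1,2) cb \<open>\<rho> > 0\<close>]]] by simp
    then have "integral {0..1} ?b = M + Re (k z0)" by (rule integral_unique)
    finally show ?thesis .
  qed
  also have "(LINT x:{0..1}|lborel. \<eta> * indicator J x) = \<eta> * d'"
  proof -
    have "(\<lambda>x. indicator {0..1} x *\<^sub>R (\<eta> * indicator J x)) = (\<lambda>x::real. \<eta> * indicator J x)"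
      using J by (auto simp: indicator_def fun_eq_iff)
    then show ?thesis unfolding set_lebesgue_integral_def using d' by (simp add: J_def)
  qed
  finally have "\<eta> * d' \<le> 0" using eq by simp
  then show False using \<open>\<eta> > 0\<close> d' by (simp add: mult_le_0_iff)
qed

text \<open>Near \<open>w0\<close> the map \<open>F\<close> has a holomorphic inverse \<open>G\<close>, so the maximum of \<open>w \<circ> F - Re h\<close> at \<open>w0\<close>
is a maximum of \<open>w - Re (h \<circ> G)\<close> at \<open>F w0\<close>, and circles around \<open>F w0\<close> are available there.\<close>

lemma submean_comp_max_open:
  assumes w: "usc_real w" "submean w"
    and F: "F holomorphic_on S" and h: "h holomorphic_on S" and S: "open S" "w0 \<in> S" and nz: "deriv F w0 \<noteq> 0"
    and le: "\<And>z. z \<in> S \<Longrightarrow> w (F z) - Re (h z) \<le> M" and eq: "w (F w0) - Re (h w0) = M"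
  shows "\<exists>\<rho>>0. ball w0 \<rho> \<subseteq> {z\<in>S. w (F z) - Re (h z) = M}"
proof -
  obtain r where r: "r > 0" "ball w0 r \<subseteq> S" "open (F ` ball w0 r)" "inj_on F (ball w0 r)"
    using has_complex_derivative_locally_invertible[OF F S(2,1) nz] by metis
  have Fb: "F holomorphic_on ball w0 r" using F r holomorphic_on_subset by blast
  obtain g where g: "g holomorphic_on F ` ball w0 r" "\<And>z. z \<in> ball w0 r \<Longrightarrow> g (F z) = z"
    using holomorphic_has_inverse[OF Fb open_ball r(4)] by metis
  have hg: "(h \<circ> g) holomorphic_on F ` ball w0 r"
    by (rule holomorphic_on_compose_gen[OF g(1) h]) (use g r in auto)
  have "F w0 \<in> F ` ball w0 r" using r by auto
  then obtain R where R: "R > 0" "cball (F w0) R \<subseteq> F ` ball w0 r"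
    using r(3) open_contains_cball by meson
  have all: "w z1 - Re ((h \<circ> g) z1) = M" if "z1 \<in> cball (F w0) R" for z1
    by (rule submean_max_on_circles[OF w hg r(3) R(2) _ _ that]) (use g(2) le r eq in auto)
  have "open (ball w0 r \<inter> F -` ball (F w0) R)"
    by (rule continuous_open_preimage[OF holomorphic_on_imp_continuous_on[OF Fb]]) auto
  moreover have "w0 \<in> ball w0 r \<inter> F -` ball (F w0) R" using r R by auto
  ultimately obtain \<rho> where \<rho>: "\<rho> > 0" "ball w0 \<rho> \<subseteq> ball w0 r \<inter> F -` ball (F w0) R"
    using open_contains_ball by meson
  have "w (F z) - Re (h z) = M \<and> z \<in> S" if "z \<in> ball w0 \<rho>" for z
  proof -
    have z: "z \<in> ball w0 r" "F z \<in> cball (F w0) R" using \<rho>(2) that by auto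
    then show ?thesis using all[OF z(2)] g(2)[OF z(1)] r(2) by auto
  qed
  then show ?thesis using \<rho>(1) by blast
qed

text \<open>If the difference were positive somewhere, the set on which it attains its maximum would be
compact (the boundary condition keeps it away from the circle), open and nonempty.\<close>

lemma comp_maximum_principle:
  assumes w: "usc_real w" "submean w"
    and F: "F holomorphic_on ball 0 1" and h: "h holomorphic_on ball 0 1"
    and nz: "\<And>z. z \<in> ball 0 1 \<Longrightarrow> deriv F z \<noteq> 0"
    and bdry: "\<And>\<zeta> \<epsilon>. norm \<zeta> = 1 \<Longrightarrow> \<epsilon> > 0 \<Longrightarrow>
        eventually (\<lambda>z. w (F z) - Re (h z) < \<epsilon>) (at \<zeta> within ball 0 1)"
    and a: "a \<in> ball 0 1"
  shows "w (F a) \<le> Re (h a)"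
proof (rule ccontr)
  assume "\<not> w (F a) \<le> Re (h a)"
  define q where "q = (\<lambda>z. w (F z) - Re (h z))"
  define \<epsilon> where "\<epsilon> = q a"
  have "\<epsilon> > 0" using \<open>\<not> w (F a) \<le> Re (h a)\<close> by (simp add: \<epsilon>_def q_def)
  have cF: "continuous_on (ball 0 1) F" and ch: "continuous_on (ball 0 1) (\<lambda>z. Re (h z))"
    using F h by (auto intro!: continuous_intros holomorphic_on_imp_continuous_on)
  have opq: "open {z\<in>ball 0 1. q z < c}" for c
  proof -
    have "{z\<in>ball 0 1. q z < c} = (\<Union>d. (ball 0 1 \<inter> F -` {z. w z < d + c}) \<inter> (ball 0 1 \<inter> (\<lambda>z. Re (h z)) -` {d<..}))"
    proof (intro set_eqI iffI)
      fix z assume z: "z \<in> {z\<in>ball 0 1. q z < c}"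
      then obtain d where "w (F z) - c < d" "d < Re (h z)" 
        using dense[of "w (F z) - c" "Re (h z)"] by (auto simp: q_def)
      with z show "z \<in> (\<Union>d. (ball 0 1 \<inter> F -` {z. w z < d + c}) \<inter> (ball 0 1 \<inter> (\<lambda>z. Re (h z)) -` {d<..}))"
        by (auto intro!: exI[of _ d])
    qed (auto simp: q_def)
    also have "open \<dots>"
      by (intro open_UN ballI open_Int continuous_open_preimage cF ch)
         (use w(1) in \<open>auto simp: usc_real_def\<close>)
    finally show ?thesis .
  qed
  \<comment> \<open>closedness in the whole plane is where the boundary condition enters\<close>
  have cK: "compact {z\<in>ball 0 1. q z \<ge> c}" if "c > 0" for c
  proof -
    have "open (- {z\<in>ball 0 1. q z \<ge> c})"
      unfolding open_subopen[of "- {z\<in>ball 0 1. q z \<ge> c}"]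
    proof
      fix x assume x: "x \<in> - {z\<in>ball 0 1. q z \<ge> c}"
      consider "norm x < 1" | "norm x = 1" | "norm x > 1" by linarith
      then show "\<exists>T. open T \<and> x \<in> T \<and> T \<subseteq> - {z\<in>ball 0 1. q z \<ge> c}"
      proof cases
        case 1
        then show ?thesis using opq[of c] x by (intro exI[of _ "{z\<in>ball 0 1. q z < c}"]) auto
      next
        case 2
        have "eventually (\<lambda>z. q z < c) (at x within ball 0 1)"
          using bdry[OF 2 that] by (simp add: q_def)
        then obtain T where "open T" "x \<in> T" "\<And>z. z \<in> T \<Longrightarrow> z \<noteq> x \<Longrightarrow> z \<in> ball 0 1 \<Longrightarrow> q z < c"
          unfolding eventually_at_topological by blast
        then show ?thesis using 2 by (intro exI[of _ T]) force
      next
        case 3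
        then show ?thesis by (intro exI[of _ "- cball 0 1"]) auto
      qed
    qed
    then have "closed {z\<in>ball 0 1. q z \<ge> c}" by (simp add: closed_def)
    moreover have "bounded {z\<in>ball 0 1. q z \<ge> c}" 
      by (rule bounded_subset[OF bounded_ball[of 0 1]]) auto
    ultimately show ?thesis by (simp add: compact_eq_bounded_closed)
  qed
  let ?K = "{z\<in>ball 0 1. q z \<ge> \<epsilon>}"
  have "a \<in> ?K" using a by (simp add: \<epsilon>_def)
  moreover have "openin (top_of_set ?K) {z\<in>?K. q z < c}" for c
  proof -
    have "{z\<in>?K. q z < c} = ?K \<inter> {z\<in>ball 0 1. q z < c}" by auto
    then show ?thesis using opq[of c] openin_open by blast
  qed
  ultimately obtain y where y: "y \<in> ?K" "\<And>z. z \<in> ?K \<Longrightarrow> q z \<le> q y"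
    using usc_attains_sup[OF cK[OF \<open>\<epsilon> > 0\<close>], of q] by blast
  define M where "M = q y"
  have qM: "q z \<le> M" if "z \<in> ball 0 1" for z
    using y that by (cases "q z \<ge> \<epsilon>") (auto simp: M_def)
  have "M > 0" using y \<open>\<epsilon> > 0\<close> by (auto simp: M_def)
  define E where "E = {z\<in>ball 0 1. q z = M}"
  have "E = {z\<in>ball 0 1. q z \<ge> M}" using qM by (force simp: E_def)
  then have "compact E" using cK[OF \<open>M > 0\<close>] by simp
  moreover have "open E"
    unfolding open_contains_ball
  proof
    fix w0 assume "w0 \<in> E"
    then show "\<exists>e>0. ball w0 e \<subseteq> E"
      using submean_comp_max_open[OF w F h open_ball, of w0 M] nz qM unfolding E_def q_def by auto
  qed
  moreover have "E \<noteq> {}" using y by (auto simp: E_def M_def)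
  ultimately have "bounded (UNIV :: complex set)"
    using clopen[of E] compact_imp_closed[of E] compact_imp_bounded[of E] by auto
  then show False by simp
qed

section \<open>Poisson majorants\<close>

text \<open>The Poisson integral of a continuous majorant on the circle is harmonic and attains the boundary
values \<open>\<kappa>\<close>, so the maximum principle applies to it.\<close>

lemma poisson_majorant_continuous:
  assumes w: "usc_real w" "submean w"
    and F: "F holomorphic_on ball 0 R" "R > 1" and nz: "\<And>z. z \<in> ball 0 1 \<Longrightarrow> deriv F z \<noteq> 0"
    and \<kappa>: "continuous_on (sphere 0 1) \<kappa>" and le: "\<And>\<zeta>. norm \<zeta> = 1 \<Longrightarrow> w (F \<zeta>) \<le> \<kappa> \<zeta>"
    and z: "norm z < 1"
  shows "w (F z) \<le> integral {0..1} (\<lambda>x. Re (schwarz_kernel z x) * \<kappa> (circ x))"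
proof -
  have c: "continuous_on {0..1} (\<lambda>x. \<kappa> (circ x))"
    by (rule continuous_on_compose2[OF \<kappa> continuous_on_circ]) auto
  have "w (F z) \<le> Re (schwarz_int (\<lambda>x. \<kappa> (circ x)) z)"
  proof (rule comp_maximum_principle[OF w _ schwarz_int_holomorphic[OF c] nz])
    show "F holomorphic_on ball 0 1" by (rule holomorphic_on_subset[OF F(1)]) (use F(2) in auto)
    fix \<zeta> :: complex and \<epsilon> :: real assume \<zeta>: "norm \<zeta> = 1" and "\<epsilon> > 0"
    obtain y where y: "y \<in> {0..<1}" "\<zeta> = circ y" using circ_surj[OF \<zeta>] .
    have "((\<lambda>z. Re (schwarz_int (\<lambda>x. \<kappa> (circ x)) z)) \<longlongrightarrow> \<kappa> (circ y)) (at (circ y) within ball 0 1)"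
    proof (rule poisson_boundary_limit[OF c])
      fix \<epsilon> :: real assume "\<epsilon> > 0"
      then obtain \<delta> where "\<delta> > 0" "\<And>v. v \<in> sphere 0 1 \<Longrightarrow> dist v (circ y) < \<delta> \<Longrightarrow> dist (\<kappa> v) (\<kappa> (circ y)) < \<epsilon>"
        using \<kappa>[unfolded continuous_on_iff, rule_format, of "circ y" \<epsilon>] by auto
      then show "\<exists>\<delta>>0. \<forall>x\<in>{0..1}. cmod (circ x - circ y) < \<delta> \<longrightarrow> \<bar>\<kappa> (circ x) - \<kappa> (circ y)\<bar> < \<epsilon>"
        by (intro exI[of _ \<delta>]) (auto simp: dist_norm dist_real_def)
    qed (use y in auto)
    then have 1: "eventually (\<lambda>z. Re (schwarz_int (\<lambda>x. \<kappa> (circ x)) z) > \<kappa> \<zeta> - \<epsilon>/2) (at \<zeta> within ball 0 1)"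
      using \<open>\<epsilon> > 0\<close> unfolding y(2)[symmetric] by (intro order_tendstoD) auto
    have "continuous (at \<zeta>) F"
      using F \<zeta> by (auto intro!: continuous_on_interior[OF holomorphic_on_imp_continuous_on[OF F(1)]])
    then have "(F \<longlongrightarrow> F \<zeta>) (at \<zeta> within ball 0 1)"
      using continuous_at_imp_continuous_at_within continuous_within by blast
    moreover have "open {u. w u < \<kappa> \<zeta> + \<epsilon>/2}" "F \<zeta> \<in> {u. w u < \<kappa> \<zeta> + \<epsilon>/2}"
      using w(1) le[OF \<zeta>] \<open>\<epsilon> > 0\<close> by (auto simp: usc_real_def)
    ultimately have 2: "eventually (\<lambda>z. F z \<in> {u. w u < \<kappa> \<zeta> + \<epsilon>/2}) (at \<zeta> within ball 0 1)"
      using topological_tendstoD by blast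
    show "eventually (\<lambda>z. w (F z) - Re (schwarz_int (\<lambda>x. \<kappa> (circ x)) z) < \<epsilon>) (at \<zeta> within ball 0 1)"
      using 1 2 by eventually_elim auto
  qed (use z in auto)
  then show ?thesis using Re_schwarz_int[OF z c] by simp
qed

lemma sphere_ne: "sphere (0::complex) 1 \<noteq> {}"
proof -
  have "(1::complex) \<in> sphere 0 1" by simp
  then show ?thesis by blast
qed

text \<open>The supremal convolution of \<open>v\<close> on the circle: Lipschitz functions that decrease to \<open>v\<close> if \<open>v\<close>
is upper semicontinuous and bounded above.\<close>

definition sup_conv :: "(complex \<Rightarrow> real) \<Rightarrow> nat \<Rightarrow> complex \<Rightarrow> real" where
  "sup_conv v n z = (SUP \<zeta>\<in>sphere 0 1. v \<zeta> - real n * norm (z - \<zeta>))"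

context
  fixes v :: "complex \<Rightarrow> real" and K :: real
  assumes usc: "\<And>c. openin (top_of_set (sphere 0 1)) {z\<in>sphere 0 1. v z < c}"
    and bd: "\<And>z. z \<in> sphere 0 1 \<Longrightarrow> v z \<le> K"
begin

lemma sup_conv_bdd: "bdd_above ((\<lambda>\<zeta>. v \<zeta> - real n * norm (z - \<zeta>)) ` sphere 0 1)"
proof -
  have "v \<zeta> - real n * norm (z - \<zeta>) \<le> K" if "\<zeta> \<in> sphere 0 1" for \<zeta>
    using bd[OF that] mult_nonneg_nonneg[OF of_nat_0_le_iff norm_ge_zero, of n "z - \<zeta>"] by linarith
  then show ?thesis unfolding bdd_above_def by blast
qed

lemma sup_conv_le_bound: "sup_conv v n z \<le> K"
  unfolding sup_conv_def
proof (rule cSUP_least[OF sphere_ne])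
  fix \<zeta> :: complex assume "\<zeta> \<in> sphere 0 1"
  then show "v \<zeta> - real n * norm (z - \<zeta>) \<le> K"
    using bd[of \<zeta>] mult_nonneg_nonneg[OF of_nat_0_le_iff norm_ge_zero, of n "z - \<zeta>"] by linarith
qed

lemma sup_conv_ge: "z \<in> sphere 0 1 \<Longrightarrow> v z \<le> sup_conv v n z"
  using cSUP_upper[OF _ sup_conv_bdd, of z n z] by (simp add: sup_conv_def)

lemma sup_conv_lip: "sup_conv v n z \<le> sup_conv v n z' + real n * norm (z - z')"
  unfolding sup_conv_def
proof (rule cSUP_least[OF sphere_ne])
  fix \<zeta> :: complex assume \<zeta>: "\<zeta> \<in> sphere 0 1"
  have "norm (z' - \<zeta>) \<le> norm (z - \<zeta>) + norm (z - z')"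
    using norm_triangle_ineq[of "z - \<zeta>" "z' - z"] by (simp add: norm_minus_commute)
  then have "real n * norm (z' - \<zeta>) \<le> real n * norm (z - \<zeta>) + real n * norm (z - z')"
    using mult_left_mono[of _ _ "real n"] by (simp flip: distrib_left)
  moreover have "v \<zeta> - real n * norm (z' - \<zeta>) \<le> (SUP \<zeta>\<in>sphere 0 1. v \<zeta> - real n * norm (z' - \<zeta>))"
    by (rule cSUP_upper[OF \<zeta> sup_conv_bdd])
  ultimately show "v \<zeta> - real n * norm (z - \<zeta>)
     \<le> (SUP \<zeta>\<in>sphere 0 1. v \<zeta> - real n * norm (z' - \<zeta>)) + real n * norm (z - z')" by linarith
qed

lemma sup_conv_continuous: "continuous_on S (sup_conv v n)"
proof -
  have "(real n)-lipschitz_on S (sup_conv v n)"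
  proof (rule lipschitz_onI)
    fix x y
    show "dist (sup_conv v n x) (sup_conv v n y) \<le> real n * dist x y"
      using sup_conv_lip[of n x y] sup_conv_lip[of n y x]
      by (simp add: dist_real_def dist_norm norm_minus_commute)
  qed simp
  then show ?thesis by (rule lipschitz_on_continuous_on)
qed

lemma sup_conv_tendsto:
  assumes z: "z \<in> sphere 0 1"
  shows "(\<lambda>n. sup_conv v n z) \<longlonglongrightarrow> v z"
proof (rule order_tendstoI)
  fix a assume "a < v z"
  then show "eventually (\<lambda>n. a < sup_conv v n z) sequentially"
    using less_le_trans[OF _ sup_conv_ge[OF z]] by simp
next
  fix a assume a: "v z < a"
  then obtain b where b: "v z < b" "b < a" using dense by blast
  obtain T where T: "open T" "{y\<in>sphere 0 1. v y < b} = sphere 0 1 \<inter> T"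
    using usc[of b] unfolding openin_open by auto
  then have "z \<in> T" using b z by auto
  then obtain d where d: "d > 0" "ball z d \<subseteq> T" using T(1) open_contains_ball by meson
  obtain N where N: "real N * d > K - b" 
    using reals_Archimedean3[OF d(1)] by blast
  have "sup_conv v n z \<le> b" if "n \<ge> N" for n
    unfolding sup_conv_def
  proof (rule cSUP_least[OF sphere_ne])
    fix \<zeta> :: complex assume \<zeta>: "\<zeta> \<in> sphere 0 1"
    show "v \<zeta> - real n * norm (z - \<zeta>) \<le> b"
    proof (cases "\<zeta> \<in> ball z d")
      case True
      then have "v \<zeta> < b" using d T \<zeta> by blast
      then show ?thesis
        using mult_nonneg_nonneg[OF of_nat_0_le_iff norm_ge_zero, of n "z - \<zeta>"] by linarith
    next
      case False
      then have "real N * d \<le> real n * norm (z - \<zeta>)"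
        using that d by (intro mult_mono) (auto simp: dist_norm)
      then show ?thesis using N bd[OF \<zeta>] by linarith
    qed
  qed
  then show "eventually (\<lambda>n. sup_conv v n z < a) sequentially"
    using b by (intro eventually_sequentiallyI[of N]) force
qed

end

text \<open>Harnack: the kernel is at most \<open>(1 + r) / (1 - r)\<close> for \<open>r = \<bar>z\<bar>\<close>, which is 5 for \<open>r = 2/3\<close>.\<close>

lemma poisson_kernel_le_5:
  assumes "norm z \<le> 2/3"
  shows "Re (schwarz_kernel z x) \<le> 5"
proof -
  have z1: "norm z < 1" using assms by simp
  have "1 - norm z \<le> norm (circ x - z)" using norm_triangle_ineq2[of "circ x" z] by simp
  then have "(1 - norm z)\<^sup>2 \<le> (norm (circ x - z))\<^sup>2" using z1 by (intro power_mono) auto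
  then have "Re (schwarz_kernel z x) \<le> (1 - (norm z)\<^sup>2) / (1 - norm z)\<^sup>2"
    unfolding Re_schwarz_kernel[OF z1] using z1 by (intro divide_left_mono) (auto simp: power_le_one zero_less_mult_iff)
  also have "\<dots> = (1 + norm z) / (1 - norm z)"
  proof -
    have "1 - (norm z)\<^sup>2 = (1 + norm z) * (1 - norm z)" by (simp add: power2_eq_square algebra_simps)
    then show ?thesis using z1 by (simp add: power2_eq_square)
  qed
  also have "\<dots> \<le> 5" using assms by (simp add: divide_simps)
  finally show ?thesis .
qed

lemma poisson_majorant:
  assumes w: "usc_real w" "submean w" and w0: "\<And>z. 0 \<le> w z"
    and F: "F holomorphic_on ball 0 R" "R > 1" and nz: "\<And>z. z \<in> ball 0 1 \<Longrightarrow> deriv F z \<noteq> 0"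
    and z: "norm z \<le> 2/3"
  shows "ennreal (w (F z)) \<le> 5 * (\<integral>\<^sup>+x\<in>{0..1}. ennreal (w (F (circ x))) \<partial>lborel)"
proof -
  define v where "v = (\<lambda>\<zeta>. w (F \<zeta>))"
  have z1: "norm z < 1" using z by simp
  have cF: "continuous_on (sphere 0 1) F"
    by (rule continuous_on_subset[OF holomorphic_on_imp_continuous_on[OF F(1)]]) (use F(2) in auto)
  have usc: "openin (top_of_set (sphere 0 1)) {z\<in>sphere 0 1. v z < c}" for c
  proof -
    have "{z\<in>sphere 0 1. v z < c} = sphere 0 1 \<inter> F -` {z. w z < c}" by (auto simp: v_def)
    then show ?thesis using continuous_openin_preimage_gen[OF cF, of "{z. w z < c}"] w(1)
      by (auto simp: usc_real_def)
  qed
  obtain y where "y \<in> sphere 0 1" "\<And>z. z \<in> sphere 0 1 \<Longrightarrow> v z \<le> v y"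
    using usc_attains_sup[OF compact_sphere sphere_ne usc] by blast
  then obtain K where K: "\<And>z. z \<in> sphere 0 1 \<Longrightarrow> v z \<le> K" by blast
  note sc = usc K
  let ?k = "\<lambda>n x. sup_conv v n (circ x)"
  have k0: "0 \<le> ?k n x" for n x
    using sup_conv_ge[OF sc, of "circ x" n] w0[of "F (circ x)"] by (simp add: v_def)
  have ck: "continuous_on S (?k n)" for n S
    by (rule continuous_on_compose2[OF sup_conv_continuous[OF sc] continuous_on_circ]) auto
  have bound: "ennreal (v z) \<le> 5 * (\<integral>\<^sup>+x\<in>{0..1}. ennreal (?k n x) \<partial>lborel)" for n
  proof -
    have "v z \<le> integral {0..1} (\<lambda>x. Re (schwarz_kernel z x) * ?k n x)"
      unfolding v_def
      by (rule poisson_majorant_continuous[OF w F nz]) 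
         (use z1 sup_conv_ge[OF sc] sup_conv_continuous[OF sc] in \<open>auto simp: v_def\<close>)
    also have "\<dots> \<le> integral {0..1} (\<lambda>x. 5 * ?k n x)"
      by (intro integral_le integrable_continuous_real continuous_intros ck continuous_on_schwarz_kernel z1
           mult_right_mono poisson_kernel_le_5 z k0)
    also have "\<dots> = 5 * integral {0..1} (?k n)" by simp
    finally have "ennreal (v z) \<le> ennreal (5 * integral {0..1} (?k n))" by (rule ennreal_leI)
    also have "\<dots> = 5 * ennreal (integral {0..1} (?k n))" by (subst ennreal_mult') auto
    also have "ennreal (integral {0..1} (?k n)) = (\<integral>\<^sup>+x\<in>{0..1}. ennreal (?k n x) \<partial>lborel)"
    proof -
      have "(\<integral>\<^sup>+x. ennreal (?k n x) * indicator {0..1} x \<partial>lborel) = ennreal (integral {0..1} (?k n))"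
        by (intro nn_integral_has_integral_lebesgue' k0 integrable_integral
              integrable_continuous_real ck)
      then show ?thesis by simp
    qed
    finally show ?thesis .
  qed
  have "(\<lambda>n. \<integral>\<^sup>+x. ennreal (?k n x) * indicator {0..1} x \<partial>lborel) \<longlonglongrightarrow> (\<integral>\<^sup>+x. ennreal (v (circ x)) * indicator {0..1} x \<partial>lborel)"
  proof (rule nn_integral_dominated_convergence)
    show "(\<lambda>x. ennreal (?k n x) * indicator {0..1} x) \<in> borel_measurable lborel" for n
      using borel_measurable_continuous_onI[OF ck, of n] by measurable
    have "(\<lambda>x. w (F (circ x))) \<in> borel_measurable borel"
      by (rule measurable_compose[OF _ usc_real_measurable[OF w(1)]])
         (auto intro!: borel_measurable_continuous_onI continuous_on_compose2[OF cF continuous_on_circ])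
    then show "(\<lambda>x. ennreal (v (circ x)) * indicator {0..1} x) \<in> borel_measurable lborel"
      unfolding v_def by measurable
    show "(\<lambda>x. ennreal K * indicator {0..1::real} x) \<in> borel_measurable lborel" by measurable
    show "(\<integral>\<^sup>+x. ennreal K * indicator {0..1::real} x \<partial>lborel) < \<infinity>"
      by (subst nn_integral_cmult_indicator) auto
    show "AE x in lborel. ennreal (?k n x) * indicator {0..1} x \<le> ennreal K * indicator {0..1} x" for n
      by (intro AE_I2 mult_right_mono ennreal_leI sup_conv_le_bound[OF sc]) auto
    show "AE x in lborel. (\<lambda>n. ennreal (?k n x) * indicator {0..1} x) \<longlonglongrightarrow> ennreal (v (circ x)) * indicator {0..1} x"
    proof (intro AE_I2)
      fix x :: real
      have "(\<lambda>n. ennreal (?k n x)) \<longlonglongrightarrow> ennreal (v (circ x))"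
        by (intro tendsto_ennrealI sup_conv_tendsto[OF sc]) auto
      then show "(\<lambda>n. ennreal (?k n x) * indicator {0..1} x) \<longlonglongrightarrow> ennreal (v (circ x)) * indicator {0..1} x"
        by (auto simp: indicator_def)
    qed
  qed
  then have "(\<lambda>n. 5 * (\<integral>\<^sup>+x. ennreal (?k n x) * indicator {0..1} x \<partial>lborel)) \<longlonglongrightarrow> 5 * (\<integral>\<^sup>+x. ennreal (v (circ x)) * indicator {0..1} x \<partial>lborel)"
    by (intro ennreal_tendsto_cmult) auto
  then show ?thesis
    using bound by (intro LIMSEQ_le_const) (auto simp: v_def)
qed

section \<open>A starlike map with prescribed boundary argument\<close>

text \<open>The interval \<open>[-1,2]\<close> is the one on which the deviation of \<open>\<mu>\<close> from a linear function, defined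
below, is periodic.\<close>

lemma integral_period_shift:
  fixes f :: "real \<Rightarrow> 'a::banach"
  assumes cont: "continuous_on {-1..2} f" and per: "\<And>x. x \<in> {-1..1} \<Longrightarrow> f (x + 1) = f x"
    and a: "a \<in> {-1..1}"
  shows "integral {a..a+1} f = integral {0..1} f"
proof -
  have int: "f integrable_on {c..d}" if "-1 \<le> c" "d \<le> 2" for c d
    by (rule integrable_continuous_real, rule continuous_on_subset[OF cont]) (use that in auto)
  have shift: "integral {c+1..d+1} f = integral {c..d} f" if "-1 \<le> c" "d \<le> 1" for c d
  proof -
    have "integral {c+1..d+1} f = integral {c+1-1..d+1-1} (\<lambda>x. f (x + 1))"
      by (rule integral_shift_real_ivl[symmetric])
    also have "\<dots> = integral {c..d} f"
      using that by (auto intro!: integral_cong per)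
    finally show ?thesis .
  qed
  note comb = Henstock_Kurzweil_Integration.integral_combine
  show ?thesis
  proof (cases "a \<ge> 0")
    case True
    have "integral {0..a} f + integral {a..a+1} f = integral {0..a+1} f"
      using True a by (intro comb int) auto
    moreover have "integral {0..1} f + integral {1..a+1} f = integral {0..a+1} f"
      using True a by (intro comb int) auto
    moreover have "integral {1..a+1} f = integral {0..a} f" using shift[of 0 a] a by simp
    ultimately show ?thesis by (metis add.commute add_right_imp_eq)
  next
    case False
    have "integral {a..0} f + integral {0..a+1} f = integral {a..a+1} f"
      using False a by (intro comb int) auto
    moreover have "integral {0..a+1} f + integral {a+1..1} f = integral {0..1} f"
      using False a by (intro comb int) auto
    moreover have "integral {a+1..1} f = integral {a..0} f" using shift[of a 0] a by simp
    ultimately show ?thesis by (metis add.commute)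
  qed
qed

lemma schwarz_kernel_rotate:
  "schwarz_kernel (of_real \<rho> * circ y) (t + y) = schwarz_kernel (of_real \<rho>) t"
proof -
  have "circ (t + y) + of_real \<rho> * circ y = (circ t + of_real \<rho>) * circ y"
    "circ (t + y) - of_real \<rho> * circ y = (circ t - of_real \<rho>) * circ y"
    by (simp_all add: circ_add algebra_simps)
  then show ?thesis by (simp add: schwarz_kernel_def)
qed

lemma schwarz_int_centered:
  assumes cont: "continuous_on {-1..2} \<psi>" and per: "\<And>x. x \<in> {-1..1} \<Longrightarrow> \<psi> (x + 1) = \<psi> x"
    and y: "y \<in> {-1/2..3/2}" and \<rho>: "0 \<le> \<rho>" "\<rho> < 1"
  shows "schwarz_int \<psi> (of_real \<rho> * circ y) =
     integral {-1/2..1/2} (\<lambda>t. schwarz_kernel (of_real \<rho>) t * of_real (\<psi> (t + y)))"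
proof -
  let ?w = "of_real \<rho> * circ y"
  let ?f = "\<lambda>x. schwarz_kernel ?w x * of_real (\<psi> x)"
  have w: "norm ?w < 1" using \<rho> by (simp add: norm_mult)
  have "schwarz_int \<psi> ?w = integral {y-1/2..y-1/2+1} ?f"
    unfolding schwarz_int_def
  proof (rule integral_period_shift[symmetric])
    show "continuous_on {-1..2} ?f"
      by (intro continuous_intros continuous_on_schwarz_kernel w cont)
    show "?f (x + 1) = ?f x" if "x \<in> {-1..1}" for x
      using per[OF that] by (simp add: schwarz_kernel_def circ_add)
  qed (use y in auto)
  also have "\<dots> = integral {y-1/2-y..y-1/2+1-y} (\<lambda>t. ?f (t + y))"
    by (rule integral_shift_real_ivl[symmetric])
  finally show ?thesis by (simp add: schwarz_kernel_rotate)
qed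

lemma Im_schwarz_kernel_real:
  "Im (schwarz_kernel (of_real \<rho>) t) = - (2 * \<rho> * sin (2 * pi * t)) / (norm (circ t - of_real \<rho>))\<^sup>2"
  unfolding schwarz_kernel_def Im_divide cmod_power2 by (simp add: circ_def algebra_simps)

lemma Im_schwarz_kernel_odd:
  "Im (schwarz_kernel (of_real \<rho>) (- t)) = - Im (schwarz_kernel (of_real \<rho>) t)"
  unfolding Im_schwarz_kernel_real cmod_power2 by (simp add: circ_def)

text \<open>Up to \<open>t = 1/6\<close> the distance is at least the imaginary part \<open>sin (2 \<pi> t) \<ge> \<pi> t\<close>; beyond that,
the angle at 0 is at least \<open>\<pi> / 3\<close> and the distance at least \<open>\<surd>3 / 2\<close>, hence at least \<open>1/2\<close>.\<close>

lemma norm_circ_minus_real_ge: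
  assumes \<rho>: "0 \<le> \<rho>" "\<rho> < 1" and t: "0 \<le> t" "t \<le> 1/2"
  shows "t \<le> norm (circ t - of_real \<rho>)"
proof (cases "t \<le> 1/6")
  case True
  define x where "x = 2 * pi * t"
  have x: "0 \<le> x" "x \<le> pi/3" using True t by (auto simp: x_def)
  have "x/2 \<le> sin x"
  proof (cases "x = 0")
    case False
    then have "0 < x" using x by simp
    then obtain z where z: "0 < z" "z < x" "sin x - sin 0 = (x - 0) * cos z"
      using MVT2[of 0 x sin cos] by (auto intro: DERIV_sin)
    have "cos (pi/3) \<le> cos z" using z x by (intro cos_monotone_0_pi_le) auto
    then have "1/2 \<le> cos z" by (simp add: cos_60)
    then show ?thesis using z \<open>0 < x\<close> mult_left_mono[of "1/2" "cos z" x] by simp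
  qed simp
  then have "pi * t \<le> sin (2 * pi * t)" by (simp add: x_def)
  moreover have "t \<le> pi * t" using t pi_ge_two mult_right_mono[of 1 pi t] by simp
  moreover have "sin (2 * pi * t) \<le> norm (circ t - of_real \<rho>)"
    using abs_Im_le_cmod[of "circ t - of_real \<rho>"] by (simp add: circ_def)
  ultimately show ?thesis by linarith
next
  case False
  have "cos (2 * pi * t) \<le> cos (pi/3)" using False t by (intro cos_monotone_0_pi_le) auto
  then have c: "cos (2 * pi * t) \<le> 1/2" by (simp add: cos_60)
  have "(norm (circ t - of_real \<rho>))\<^sup>2 = 1 - 2 * \<rho> * cos (2*pi*t) + \<rho>\<^sup>2"
    unfolding cmod_power2 using sin_cos_squared_add[of "2*pi*t"]
    by (simp add: circ_def power2_eq_square algebra_simps)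
  moreover have "\<rho> * cos (2*pi*t) \<le> \<rho> * (1/2)" using c \<rho> by (intro mult_left_mono) auto
  moreover have "0 \<le> (\<rho> - 1/2)\<^sup>2" by simp
  ultimately have "(1/2)\<^sup>2 \<le> (norm (circ t - of_real \<rho>))\<^sup>2"
    by (simp add: power2_eq_square algebra_simps)
  then have "1/2 \<le> norm (circ t - of_real \<rho>)" by (rule power2_le_imp_le) simp
  then show ?thesis using t by simp
qed

text \<open>The bound that links the conjugate function with the integrals in the class \<open>\<A>\<close>; it is uniform
in \<open>\<rho>\<close>.\<close>

lemma conjugate_kernel_le:
  assumes \<rho>: "0 \<le> \<rho>" "\<rho> < 1" and t: "0 < t" "t \<le> 1/2"
  shows "\<bar>Im (schwarz_kernel (of_real \<rho>) t)\<bar> \<le> 2 / t"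
proof -
  let ?N = "norm (circ t - of_real \<rho>)"
  have N: "t \<le> ?N" using norm_circ_minus_real_ge[of \<rho> t] assms by simp
  have N0: "0 < ?N" using N t by linarith
  have "\<bar>sin (2 * pi * t)\<bar> \<le> ?N"
    using abs_Im_le_cmod[of "circ t - of_real \<rho>"] by (simp add: circ_def)
  then have "2 * \<rho> * \<bar>sin (2 * pi * t)\<bar> \<le> 2 * 1 * ?N" using \<rho> by (intro mult_mono) auto
  then have "\<bar>Im (schwarz_kernel (of_real \<rho>) t)\<bar> \<le> 2 * ?N / ?N\<^sup>2"
    unfolding Im_schwarz_kernel_real using \<rho> by (auto simp: abs_mult intro!: divide_right_mono)
  also have "\<dots> = 2 / ?N" using N0 by (simp add: power2_eq_square)
  also have "\<dots> \<le> 2 / t" using N t by (intro frac_le) auto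
  finally show ?thesis .
qed

lemma ennreal_sum3:
  assumes "0 \<le> a" "0 \<le> b" "0 \<le> c" "0 \<le> e"
  shows "ennreal (2 * (a + b + c) + e) = 2 * (ennreal a + ennreal b + ennreal c) + ennreal e"
proof -
  have "ennreal (2 * (a + b + c) + e) = ennreal (2 * (a + b + c)) + ennreal e"
    by (rule ennreal_plus) (use assms in auto)
  also have "ennreal (2 * (a + b + c)) = ennreal 2 * ennreal (a + b + c)"
    by (rule ennreal_mult') simp
  also have "ennreal (a + b + c) = ennreal a + ennreal b + ennreal c"
    using assms by (simp add: ennreal_plus)
  finally show ?thesis by simp
qed

context
  fixes \<mu> :: "real \<Rightarrow> real" and \<delta> :: real
  assumes \<mu>_cont: "continuous_on UNIV \<mu>" and \<mu>_mono: "mono \<mu>"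
    and \<mu>_0: "\<And>x. x \<le> 0 \<Longrightarrow> \<mu> x = 0" and \<mu>_1: "\<And>x. x \<ge> 1 \<Longrightarrow> \<mu> x = 2 * pi"
    and \<delta>: "\<delta> > 0"
    and dini: "\<And>y. (\<integral>\<^sup>+t\<in>{0<..\<delta>}. ennreal ((\<mu> (y + t) - \<mu> (y - t)) / t) \<partial>lborel) \<le> 1"
begin

text \<open>On \<open>[-1,2]\<close> this is the lift of \<open>\<mu>\<close> with \<open>lift_fun (x + 1) = lift_fun x + 2 \<pi>\<close>: the translates
of \<open>\<mu>\<close> are constant outside an interval of length 1, and three of them cover \<open>[-1,2]\<close>.  Being a
sum of translates of \<open>\<mu>\<close>, it inherits the bound on the integrals \<open>dini\<close>.\<close>

definition lift_fun :: "real \<Rightarrow> real" where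
  "lift_fun x = \<mu> x + \<mu> (x - 1) + \<mu> (x + 1) - 2 * pi"

definition dev_fun :: "real \<Rightarrow> real" where
  "dev_fun x = lift_fun x - 2 * pi * x"

lemma \<mu>_comp_cont: "continuous_on S h \<Longrightarrow> continuous_on S (\<lambda>x. \<mu> (h x))"
  by (rule continuous_on_compose2[OF \<mu>_cont]) auto

lemma dev_cont: "continuous_on S h \<Longrightarrow> continuous_on S (\<lambda>x. dev_fun (h x))"
  unfolding dev_fun_def lift_fun_def by (intro continuous_intros \<mu>_comp_cont)

lemma \<mu>_range: "0 \<le> \<mu> x" "\<mu> x \<le> 2 * pi"
  using monoD[OF \<mu>_mono, of 0 x] monoD[OF \<mu>_mono, of x 1] \<mu>_0[of 0] \<mu>_0[of x] \<mu>_1[of 1] \<mu>_1[of x]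
  by (cases "x \<le> 0"; cases "x \<ge> 1"; simp)+

lemma lift_mono: "x \<le> y \<Longrightarrow> lift_fun x \<le> lift_fun y"
  unfolding lift_fun_def using \<mu>_mono by (auto intro!: add_mono diff_right_mono dest: monoD)

lemma dev_period: "x \<in> {-1..1} \<Longrightarrow> dev_fun (x + 1) = dev_fun x"
  using \<mu>_0[of "x - 1"] \<mu>_1[of "x + 1 + 1"] by (simp add: dev_fun_def lift_fun_def algebra_simps)

lemma dev_01: "x \<in> {0..1} \<Longrightarrow> dev_fun x = \<mu> x - 2 * pi * x"
  using \<mu>_0[of "x - 1"] \<mu>_1[of "x + 1"] by (simp add: dev_fun_def lift_fun_def)

text \<open>Beyond \<open>\<delta>\<close> the integrand is at most \<open>2 \<pi> / \<delta>\<close>, because \<open>\<mu>\<close> has values in \<open>[0, 2 \<pi>]\<close>.\<close>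

lemma dini_half: "(\<integral>\<^sup>+t. ennreal ((\<mu> (y + t) - \<mu> (y - t)) / t) * indicator {0<..1/2} t \<partial>lborel)
     \<le> ennreal (1 + 2 * pi / \<delta>)"
proof -
  let ?D = "\<lambda>t. ennreal ((\<mu> (y + t) - \<mu> (y - t)) / t)"
  have [measurable]: "\<mu> \<in> borel_measurable borel" by (rule borel_measurable_continuous_onI[OF \<mu>_cont])
  have "(\<integral>\<^sup>+t. ?D t * indicator {0<..1/2} t \<partial>lborel)
     \<le> (\<integral>\<^sup>+t. ?D t * indicator {0<..\<delta>} t + ennreal (2 * pi / \<delta>) * indicator {0..1} t \<partial>lborel)"
  proof (rule nn_integral_mono)
    fix t :: real
    show "?D t * indicator {0<..1/2} t \<le> ?D t * indicator {0<..\<delta>} t + ennreal (2 * pi / \<delta>) * indicator {0..1} t"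
    proof (cases "t \<in> {0<..1/2} \<and> t > \<delta>")
      case True
      have "(\<mu> (y + t) - \<mu> (y - t)) / t \<le> 2 * pi / \<delta>"
        using True \<mu>_range[of "y+t"] \<mu>_range[of "y-t"] \<delta> by (intro frac_le) auto
      then show ?thesis using True by (auto simp: ennreal_leI)
    qed (auto simp: indicator_def)
  qed
  also have "\<dots> = (\<integral>\<^sup>+t. ?D t * indicator {0<..\<delta>} t \<partial>lborel) + (\<integral>\<^sup>+t. ennreal (2 * pi / \<delta>) * indicator {0..1::real} t \<partial>lborel)"
    by (rule nn_integral_add) measurable
  also have "\<dots> \<le> 1 + ennreal (2 * pi / \<delta>)"
    using dini[of y] by (intro add_mono) (simp_all add: nn_integral_cmult_indicator)
  also have "\<dots> = ennreal (1 + 2 * pi / \<delta>)" using \<delta> by (simp add: ennreal_plus)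
  finally show ?thesis .
qed

text \<open>Three translates of \<open>\<mu>\<close>, each contributing twice \<open>1 + 2 \<pi> / \<delta>\<close>, and \<open>8 \<pi>\<close> from the linear
term of \<open>dev_fun\<close>.\<close>

definition conj_bound :: real where
  "conj_bound = 6 * (1 + 2 * pi / \<delta>) + 8 * pi"

text \<open>The conjugate kernel is odd, so the integral can be folded onto \<open>[0, 1/2]\<close>, where only the
symmetric differences of \<open>dev_fun\<close> at \<open>y\<close> remain.\<close>

lemma conjugate_bounded:
  assumes \<rho>: "0 \<le> \<rho>" "\<rho> < 1" and y: "y \<in> {-1/2..3/2}"
  shows "\<bar>Im (schwarz_int dev_fun (of_real \<rho> * circ y))\<bar> \<le> conj_bound"
proof -
  let ?q = "\<lambda>t. Im (schwarz_kernel (of_real \<rho>) t)"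
  let ?I = "\<lambda>t. ?q t * (dev_fun (y + t) - dev_fun (y - t))"
  have [measurable]: "\<mu> \<in> borel_measurable borel" by (rule borel_measurable_continuous_onI[OF \<mu>_cont])
  have \<rho>1: "norm (of_real \<rho> :: complex) < 1" using \<rho> by simp
  have cq: "continuous_on S ?q" for S by (intro continuous_intros continuous_on_schwarz_kernel \<rho>1)
  have "Im (schwarz_int dev_fun (of_real \<rho> * circ y)) =
     Im (integral {-1/2..1/2} (\<lambda>t. schwarz_kernel (of_real \<rho>) t * of_real (dev_fun (t + y))))"
    by (subst schwarz_int_centered[where \<psi>=dev_fun, OF _ dev_period y \<rho>]) (auto intro!: dev_cont continuous_intros)
  also have "\<dots> = integral {-1/2..1/2} (\<lambda>t. ?q t * dev_fun (t + y))"
    by (subst integral_linear[OF _ bounded_linear_Im, unfolded o_def, symmetric])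
       (auto intro!: integrable_continuous_real dev_cont continuous_intros continuous_on_schwarz_kernel \<rho>1)
  also have "\<dots> = integral {-1/2..0} (\<lambda>t. ?q t * dev_fun (t + y)) + integral {0..1/2} (\<lambda>t. ?q t * dev_fun (t + y))"
    by (rule Henstock_Kurzweil_Integration.integral_combine[symmetric])
       (auto intro!: integrable_continuous_real dev_cont continuous_intros cq)
  also have "integral {-1/2..0} (\<lambda>t. ?q t * dev_fun (t + y)) = integral {0..1/2} (\<lambda>t. - (?q t * dev_fun (y - t)))"
    using Henstock_Kurzweil_Integration.integral_reflect_real[of "1/2" 0 "\<lambda>t. - (?q t * dev_fun (y - t))"]
    by (simp add: Im_schwarz_kernel_odd add.commute)
  also have "\<dots> + integral {0..1/2} (\<lambda>t. ?q t * dev_fun (t + y)) = integral {0..1/2} ?I"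
    by (subst Henstock_Kurzweil_Integration.integral_add[symmetric])
       (auto intro!: integrable_continuous_real dev_cont continuous_intros cq integral_cong simp: algebra_simps)
  finally have eq: "Im (schwarz_int dev_fun (of_real \<rho> * circ y)) = integral {0..1/2} ?I" .
  have int: "set_integrable lborel {0..1/2} ?I"
    by (rule borel_integrable_atLeastAtMost') (auto intro!: dev_cont continuous_intros cq)
  let ?D = "\<lambda>z t. ennreal ((\<mu> (z + t) - \<mu> (z - t)) / t) * indicator {0<..1/2} t"
  have "ennreal \<bar>integral {0..1/2} ?I\<bar> = ennreal (norm (LINT t:{0..1/2}|lborel. ?I t))"
    by (simp add: set_borel_integral_eq_integral(2)[OF int])
  also have "\<dots> \<le> (\<integral>\<^sup>+t. norm (indicator {0..1/2} t *\<^sub>R ?I t) \<partial>lborel)"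
    unfolding set_lebesgue_integral_def
    by (rule integral_norm_bound_ennreal) (use int in \<open>simp add: set_integrable_def\<close>)
  also have "\<dots> \<le> (\<integral>\<^sup>+t. 2 * (?D y t + ?D (y - 1) t + ?D (y + 1) t) + ennreal (8 * pi) * indicator {0..1} t \<partial>lborel)"
  proof (rule nn_integral_mono)
    fix t :: real
    show "ennreal (norm (indicator {0..1/2} t *\<^sub>R ?I t))
       \<le> 2 * (?D y t + ?D (y - 1) t + ?D (y + 1) t) + ennreal (8 * pi) * indicator {0..1} t"
    proof (cases "t \<in> {0<..1/2}")
      case True
      then have t: "0 < t" "t \<le> 1/2" by auto
      let ?d = "\<lambda>z. \<mu> (z + t) - \<mu> (z - t)"
      have d0: "0 \<le> ?d z" for z using monoD[OF \<mu>_mono, of "z - t" "z + t"] t by simp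
      have "dev_fun (y + t) - dev_fun (y - t) = ?d y + ?d (y - 1) + ?d (y + 1) - 4 * pi * t"
        by (simp add: dev_fun_def lift_fun_def algebra_simps)
      then have "\<bar>dev_fun (y + t) - dev_fun (y - t)\<bar> \<le> ?d y + ?d (y - 1) + ?d (y + 1) + 4 * pi * t"
      proof -
        have "0 \<le> 4 * pi * t" using t by simp
        moreover note eq = \<open>dev_fun (y + t) - dev_fun (y - t) = _\<close>
        ultimately show ?thesis unfolding eq using d0[of y] d0[of "y-1"] d0[of "y+1"] by linarith
      qed
      then have "\<bar>?I t\<bar> \<le> 2 / t * (?d y + ?d (y - 1) + ?d (y + 1) + 4 * pi * t)"
        unfolding abs_mult using conjugate_kernel_le[OF \<rho> t] t by (intro mult_mono) auto
      also have "\<dots> = 2 * (?d y / t + ?d (y - 1) / t + ?d (y + 1) / t) + 8 * pi"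
        using t by (simp add: field_simps)
      \<comment> \<open>the factor \<open>2 / t\<close> of the kernel provides the denominator of the class condition\<close>
      finally have "ennreal \<bar>?I t\<bar> \<le> ennreal (2 * (?d y / t + ?d (y - 1) / t + ?d (y + 1) / t) + 8 * pi)"
        by (rule ennreal_leI)
      also have "\<dots> = 2 * (ennreal (?d y / t) + ennreal (?d (y - 1) / t) + ennreal (?d (y + 1) / t)) + ennreal (8 * pi)"
        by (rule ennreal_sum3) (use d0 t in auto)
      finally show ?thesis using t by simp
    next
      case False
      then show ?thesis by (cases "t = 0") (auto simp: indicator_def Im_schwarz_kernel_real)
    qed
  qed
  also have "\<dots> = 2 * ((\<integral>\<^sup>+t. ?D y t \<partial>lborel) + (\<integral>\<^sup>+t. ?D (y-1) t \<partial>lborel) + (\<integral>\<^sup>+t. ?D (y+1) t \<partial>lborel))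
       + (\<integral>\<^sup>+t. ennreal (8 * pi) * indicator {0..1::real} t \<partial>lborel)"
    by (simp add: nn_integral_add nn_integral_cmult)
  also have "\<dots> \<le> 2 * (ennreal (1 + 2 * pi / \<delta>) + ennreal (1 + 2 * pi / \<delta>) + ennreal (1 + 2 * pi / \<delta>)) + ennreal (8 * pi)"
    by (intro add_mono mult_left_mono dini_half) (simp_all add: nn_integral_cmult_indicator)
  also have "\<dots> = ennreal conj_bound"
    using \<delta> by (subst ennreal_sum3[symmetric]) (simp_all add: conj_bound_def)
  finally have "\<bar>integral {0..1/2} ?I\<bar> \<le> conj_bound"
    using \<delta> by (subst (asm) ennreal_le_iff) (auto simp: conj_bound_def)
  then show ?thesis using eq by simp
qed

text \<open>The Poisson integral of \<open>dev_fun\<close>, centred at \<open>y\<close>, plus \<open>2 \<pi> y\<close> is the mean of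
\<open>lift_fun (t + y) - 2 \<pi> t\<close> against a positive kernel independent of \<open>y\<close>, and \<open>lift_fun\<close> is
increasing.\<close>

lemma angle_mono:
  assumes \<rho>: "0 \<le> \<rho>" "\<rho> < 1"
  shows "mono_on {-1/2..3/2} (\<lambda>y. 2 * pi * y + Re (schwarz_int dev_fun (of_real \<rho> * circ y)))"
proof (rule mono_onI)
  let ?p = "\<lambda>t. Re (schwarz_kernel (of_real \<rho>) t)"
  have \<rho>1: "norm (of_real \<rho> :: complex) < 1" using \<rho> by simp
  have cp: "continuous_on S ?p" for S by (intro continuous_intros continuous_on_schwarz_kernel \<rho>1)
  have p1: "integral {-1/2..1/2} ?p = 1"
  proof -
    have "Re (schwarz_int (\<lambda>_. 1) (of_real \<rho> * circ 0)) =
       Re (integral {-1/2..1/2} (\<lambda>t. schwarz_kernel (of_real \<rho>) t * of_real 1))"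
      by (subst schwarz_int_centered[OF _ _ _ \<rho>]) auto
    also have "\<dots> = integral {-1/2..1/2} ?p"
      by (subst integral_linear[OF _ bounded_linear_Re, unfolded o_def, symmetric])
         (auto intro!: integrable_continuous_real continuous_intros continuous_on_schwarz_kernel \<rho>1)
    finally show ?thesis using schwarz_int_const[OF \<rho>1] by simp
  qed
  have T: "2 * pi * y + Re (schwarz_int dev_fun (of_real \<rho> * circ y))
      = integral {-1/2..1/2} (\<lambda>t. ?p t * (lift_fun (t + y) - 2 * pi * t))" if y: "y \<in> {-1/2..3/2}" for y
  proof -
    have "Re (schwarz_int dev_fun (of_real \<rho> * circ y)) =
       Re (integral {-1/2..1/2} (\<lambda>t. schwarz_kernel (of_real \<rho>) t * of_real (dev_fun (t + y))))"
      by (subst schwarz_int_centered[where \<psi>=dev_fun, OF _ dev_period y \<rho>]) (auto intro!: dev_cont continuous_intros)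
    also have "\<dots> = integral {-1/2..1/2} (\<lambda>t. ?p t * dev_fun (t + y))"
      by (subst integral_linear[OF _ bounded_linear_Re, unfolded o_def, symmetric])
         (auto intro!: integrable_continuous_real dev_cont continuous_intros continuous_on_schwarz_kernel \<rho>1)
    finally have "2 * pi * y + Re (schwarz_int dev_fun (of_real \<rho> * circ y))
       = integral {-1/2..1/2} (\<lambda>t. ?p t * (2 * pi * y)) + integral {-1/2..1/2} (\<lambda>t. ?p t * dev_fun (t + y))"
      using p1 by simp
    also have "\<dots> = integral {-1/2..1/2} (\<lambda>t. ?p t * (2 * pi * y) + ?p t * dev_fun (t + y))"
      by (rule Henstock_Kurzweil_Integration.integral_add[symmetric])
         (auto intro!: integrable_continuous_real dev_cont continuous_intros cp)
    also have "(\<lambda>t. ?p t * (2 * pi * y) + ?p t * dev_fun (t + y)) = (\<lambda>t. ?p t * (lift_fun (t + y) - 2 * pi * t))"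
      by (simp add: dev_fun_def fun_eq_iff algebra_simps)
    finally show ?thesis .
  qed
  fix y1 y2 :: real assume y: "y1 \<in> {-1/2..3/2}" "y2 \<in> {-1/2..3/2}" "y1 \<le> y2"
  have cl: "continuous_on S (\<lambda>t. lift_fun (t + y))" for S y
    unfolding lift_fun_def by (intro continuous_intros \<mu>_comp_cont)
  show "2 * pi * y1 + Re (schwarz_int dev_fun (of_real \<rho> * circ y1))
     \<le> 2 * pi * y2 + Re (schwarz_int dev_fun (of_real \<rho> * circ y2))"
    unfolding T[OF y(1)] T[OF y(2)]
    by (intro integral_le integrable_continuous_real continuous_intros cp cl mult_left_mono
         diff_right_mono lift_mono Re_schwarz_kernel_nonneg \<rho>1) (use y in auto)
qed

text \<open>The function \<open>log (f z / z)\<close> for the map \<open>f\<close> to be constructed; multiplication by \<open>\<i>\<close> turns the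
Poisson integral of \<open>dev_fun\<close> into its imaginary part.\<close>

definition log_fun :: "complex \<Rightarrow> complex" where
  "log_fun w = \<i> * schwarz_int dev_fun w"

lemma log_fun_holomorphic: "log_fun holomorphic_on ball 0 1"
  unfolding log_fun_def [abs_def]
  by (intro holomorphic_intros schwarz_int_holomorphic) (auto intro!: dev_cont continuous_intros)

lemma log_fun_Re_bound:
  assumes "norm w < 1" shows "\<bar>Re (log_fun w)\<bar> \<le> conj_bound"
proof -
  obtain \<rho> y where w: "0 \<le> \<rho>" "\<rho> = norm w" "y \<in> {0..<1}" "w = of_real \<rho> * circ y"
    by (rule polar_circ)
  have "\<bar>Im (schwarz_int dev_fun (of_real \<rho> * circ y))\<bar> \<le> conj_bound"
    by (rule conjugate_bounded) (use w(1-3) assms in auto)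
  then show ?thesis by (simp add: log_fun_def flip: w(4))
qed

text \<open>Up to the factor \<open>2 \<pi>\<close>, the left-hand side \<open>Re (z f' z / f z)\<close> is the derivative of the
argument of \<open>f\<close> along the circle through \<open>w\<close>.\<close>

lemma starlike_nonneg:
  assumes "norm w < 1" shows "0 \<le> Re (1 + w * deriv log_fun w)"
proof -
  obtain \<rho> y where w: "0 \<le> \<rho>" "\<rho> = norm w" "y \<in> {0..<1}" "w = of_real \<rho> * circ y"
    by (rule polar_circ)
  have \<rho>1: "\<rho> < 1" using assms w(2) by simp
  let ?S = "schwarz_int dev_fun"
  have hS: "?S holomorphic_on ball 0 1" by (intro schwarz_int_holomorphic dev_cont continuous_intros)
  have dS: "(?S has_field_derivative deriv ?S w) (at w)"
    by (rule holomorphic_derivI[OF hS open_ball]) (use assms in simp)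
  have "(log_fun has_field_derivative \<i> * deriv ?S w) (at w)"
    unfolding log_fun_def [abs_def] by (rule DERIV_cmult[OF dS])
  then have dl: "deriv log_fun w = \<i> * deriv ?S w" by (rule DERIV_imp_deriv)
  have "(circ has_vector_derivative 2 * of_real pi * \<i> * circ y) (at y)"
    unfolding circ_exp [abs_def] 
    by (auto intro!: derivative_eq_intros has_vector_derivative_real_field)
  then have "((\<lambda>y. of_real \<rho> * circ y) has_vector_derivative of_real \<rho> * (2 * of_real pi * \<i> * circ y)) (at y)"
    by (rule has_vector_derivative_mult_right)
  then have "((\<lambda>y. ?S (of_real \<rho> * circ y)) has_vector_derivative
      of_real \<rho> * (2 * of_real pi * \<i> * circ y) * deriv ?S w) (at y)"
    using field_vector_diff_chain_at[of "\<lambda>y. of_real \<rho> * circ y"] dS w(4) by (simp add: o_def)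
  then have "((\<lambda>y. Re (?S (of_real \<rho> * circ y))) has_vector_derivative
      Re (of_real \<rho> * (2 * of_real pi * \<i> * circ y) * deriv ?S w)) (at y)"
    by (rule bounded_linear.has_vector_derivative[OF bounded_linear_Re])
  then have "((\<lambda>y. Re (?S (of_real \<rho> * circ y))) has_real_derivative
      Re (of_real \<rho> * (2 * of_real pi * \<i> * circ y) * deriv ?S w)) (at y)"
    by (simp add: has_real_derivative_iff_has_vector_derivative)
  then have "((\<lambda>y. 2 * pi * y + Re (?S (of_real \<rho> * circ y))) has_real_derivative
      2 * pi + Re (of_real \<rho> * (2 * of_real pi * \<i> * circ y) * deriv ?S w)) (at y)"
    by (intro DERIV_add DERIV_cmult_Id)
  moreover have "y \<in> interior {-1/2..3/2}" using w(3) by simp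
  ultimately have "0 \<le> 2 * pi + Re (of_real \<rho> * (2 * of_real pi * \<i> * circ y) * deriv ?S w)"
    using mono_on_imp_deriv_nonneg[OF angle_mono[OF w(1) \<rho>1]] by blast
  also have "\<dots> = 2 * pi * Re (1 + w * deriv log_fun w)"
  proof -
    have "Re w = \<rho> * Re (circ y)" "Im w = \<rho> * Im (circ y)" by (subst w(4), simp)+
    then show ?thesis by (simp add: dl algebra_simps)
  qed
  finally have "2 * pi * 0 \<le> 2 * pi * Re (1 + w * deriv log_fun w)" by (simp only: mult_zero_right)
  then show ?thesis by (rule mult_left_le_imp_le) simp
qed

text \<open>A holomorphic function with nonnegative real part and value 1 at 0 cannot vanish, since it would
map a neighbourhood of the zero onto a neighbourhood of 0.\<close>

lemma starlike_deriv_nz: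
  assumes w: "norm w < 1" shows "1 + w * deriv log_fun w \<noteq> 0"
proof
  assume z: "1 + w * deriv log_fun w = 0"
  let ?k = "\<lambda>w. 1 + w * deriv log_fun w"
  have hk: "?k holomorphic_on ball 0 1"
    by (intro holomorphic_intros holomorphic_deriv log_fun_holomorphic) auto
  have "\<not> ?k constant_on ball 0 1"
  proof
    assume "?k constant_on ball 0 1"
    then obtain c where "\<And>x. x \<in> ball 0 1 \<Longrightarrow> ?k x = c" unfolding constant_on_def by blast
    from this[of 0] this[of w] w z show False by simp
  qed
  then have "open (?k ` ball 0 1)"
    by (intro open_mapping_thm[OF hk]) auto
  moreover have "0 \<in> ?k ` ball 0 1" using z w by (force intro: image_eqI[of _ _ w])
  ultimately obtain e where e: "e > 0" "cball 0 e \<subseteq> ?k ` ball 0 1" using open_contains_cball by meson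
  have "complex_of_real (- e) \<in> cball 0 e" using e(1) by simp
  then obtain v where "v \<in> ball 0 1" "complex_of_real (- e) = ?k v" using e(2) by blast
  then show False using starlike_nonneg[of v] e(1) by (metis Re_complex_of_real dist_0_norm mem_ball neg_0_le_iff_le not_le)
qed

lemma starlike_map_deriv_nz:
  assumes w: "norm w < 1" shows "deriv (\<lambda>w. w * exp (log_fun w)) w \<noteq> 0"
proof -
  have "(log_fun has_field_derivative deriv log_fun w) (at w)"
    by (rule holomorphic_derivI[OF log_fun_holomorphic open_ball]) (use assms in simp)
  then have "((\<lambda>w. w * exp (log_fun w)) has_field_derivative exp (log_fun w) * (1 + w * deriv log_fun w)) (at w)"
    by (auto intro!: derivative_eq_intros simp: algebra_simps)
  then have "deriv (\<lambda>w. w * exp (log_fun w)) w = exp (log_fun w) * (1 + w * deriv log_fun w)"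
    by (rule DERIV_imp_deriv)
  then show ?thesis using starlike_deriv_nz[OF w] by simp
qed

text \<open>Only interior points are treated, where the inverse of \<open>circ\<close> is continuous; the two endpoints
form a null set in the applications.\<close>

lemma angle_limit:
  assumes y: "y \<in> {0<..<1}" and \<rho>: "\<And>n. 0 \<le> \<rho> n" "\<And>n. \<rho> n < 1" "\<rho> \<longlonglongrightarrow> 1"
  shows "(\<lambda>n. 2 * pi * y + Im (log_fun (of_real (\<rho> n) * circ y))) \<longlonglongrightarrow> \<mu> y"
proof -
  have A: "Arg2pi (circ x) = 2 * pi * x" if "x \<in> {0..<1}" for x
    using that by (intro Arg2pi_unique[of 1]) (auto simp: circ_def cis_conv_exp)
  have d10: "dev_fun 1 = dev_fun 0" using dev_period[of 0] by simp
  have dA: "dev_fun (Arg2pi (circ x) / (2 * pi)) = dev_fun x" if "x \<in> {0..1}" for x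
    using that A[of x] A[of 0] d10 by (cases "x = 1") auto
  have "circ y \<notin> \<real>\<^sub>\<ge>\<^sub>0"
  proof
    assume "circ y \<in> \<real>\<^sub>\<ge>\<^sub>0"
    then have "Arg2pi (circ y) = 0" by (auto simp: Arg2pi_eq_0 complex_nonneg_Reals_iff complex_is_Real_iff)
    then show False using A[of y] y by simp
  qed
  then have cA: "continuous (at (circ y)) (\<lambda>z. dev_fun (Arg2pi z / (2 * pi)))"
  proof -
    have "isCont dev_fun x" for x 
      using dev_cont[of UNIV "\<lambda>x. x"] by (simp add: continuous_on_eq_continuous_at)
    moreover have "continuous (at (circ y)) (\<lambda>z. Arg2pi z / (2 * pi))"
      using continuous_at_Arg2pi[OF \<open>circ y \<notin> \<real>\<^sub>\<ge>\<^sub>0\<close>] by (intro continuous_intros) auto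
    ultimately show ?thesis using isCont_o2 by blast
  qed
  have "((\<lambda>w. Re (schwarz_int dev_fun w)) \<longlongrightarrow> dev_fun y) (at (circ y) within ball 0 1)"
  proof (rule poisson_boundary_limit)
    fix \<epsilon> :: real assume "\<epsilon> > 0"
    then obtain d where d: "d > 0" "\<And>z. dist z (circ y) < d \<Longrightarrow>
        dist (dev_fun (Arg2pi z / (2 * pi))) (dev_fun (Arg2pi (circ y) / (2 * pi))) < \<epsilon>"
      using cA unfolding continuous_at_eps_delta by (metis dist_commute)
    have "\<bar>dev_fun x - dev_fun y\<bar> < \<epsilon>" if "x \<in> {0..1}" "norm (circ x - circ y) < d" for x
      using d(2)[of "circ x"] that dA[of x] dA[of y] y by (simp add: dist_norm)
    then show "\<exists>\<delta>>0. \<forall>x\<in>{0..1}. norm (circ x - circ y) < \<delta> \<longrightarrow> \<bar>dev_fun x - dev_fun y\<bar> < \<epsilon>"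
      using d(1) by blast
  qed (use y in \<open>auto intro!: dev_cont continuous_intros\<close>)
  moreover have "filterlim (\<lambda>n. of_real (\<rho> n) * circ y) (at (circ y) within ball 0 1) sequentially"
    unfolding filterlim_at
  proof
    have b: "norm (of_real (\<rho> n) * circ y) < 1" for n using \<rho> by (simp add: norm_mult)
    have "of_real (\<rho> n) * circ y \<noteq> circ y" for n using b[of n] norm_circ[of y] by (metis less_irrefl)
    with b show "\<forall>\<^sub>F n in sequentially. of_real (\<rho> n) * circ y \<in> ball 0 1 \<and> of_real (\<rho> n) * circ y \<noteq> circ y"
      by (intro always_eventually) auto
    have "(\<lambda>n. of_real (\<rho> n) * circ y) \<longlonglongrightarrow> of_real 1 * circ y" by (intro tendsto_intros \<rho>(3))
    then show "(\<lambda>n. of_real (\<rho> n) * circ y) \<longlonglongrightarrow> circ y" by simp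
  qed
  ultimately have "(\<lambda>n. Re (schwarz_int dev_fun (of_real (\<rho> n) * circ y))) \<longlonglongrightarrow> dev_fun y"
    by (rule filterlim_compose)
  then have "(\<lambda>n. 2 * pi * y + Re (schwarz_int dev_fun (of_real (\<rho> n) * circ y))) \<longlonglongrightarrow> 2 * pi * y + dev_fun y"
    by (intro tendsto_intros)
  then show ?thesis using dev_01[of y] y by (simp add: log_fun_def)
qed

end

section \<open>The positive part of a subharmonic function\<close>

text \<open>Monotonicity of the upper integrals in the two parts of \<open>ereal_integral\<close>, which holds for
functions \<open>f\<close> that are not known to be measurable.\<close>

lemma ereal_integral_le:
  assumes le: "\<And>x. x \<in> space M \<Longrightarrow> f x \<le> ereal (d x)" and d: "integrable M d"
  shows "ereal_integral M f \<le> ereal (integral\<^sup>L M d)"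
proof -
  have 1: "(\<integral>\<^sup>+x. e2ennreal (f x) \<partial>M) \<le> (\<integral>\<^sup>+x. ennreal (d x) \<partial>M)"
    by (rule nn_integral_mono) (use le e2ennreal_mono in \<open>fastforce simp flip: e2ennreal_ereal\<close>)
  have 2: "(\<integral>\<^sup>+x. ennreal (- d x) \<partial>M) \<le> (\<integral>\<^sup>+x. e2ennreal (- f x) \<partial>M)"
  proof (rule nn_integral_mono)
    fix x assume "x \<in> space M"
    then have "ereal (- d x) \<le> - f x" using le[of x] by (metis ereal_minus_le_minus uminus_ereal.simps(1))
    then show "ennreal (- d x) \<le> e2ennreal (- f x)" using e2ennreal_mono[of "ereal (- d x)"] by simp
  qed
  obtain a b where a: "0 \<le> a" "(\<integral>\<^sup>+x. ennreal (d x) \<partial>M) = ennreal a"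
    and b: "0 \<le> b" "(\<integral>\<^sup>+x. ennreal (- d x) \<partial>M) = ennreal b" and ab: "integral\<^sup>L M d = a - b"
    using integrableE[OF d] by metis
  have "ereal_integral M f \<le> enn2ereal (ennreal a) - enn2ereal (ennreal b)"
    unfolding ereal_integral_def
    by (rule ereal_minus_mono) (use 1 2 a(2) b(2) in \<open>simp_all only: less_eq_ennreal.rep_eq\<close>)
  then show ?thesis using a b ab by (simp add: enn2ereal_ennreal)
qed

definition pos_part :: "(complex \<Rightarrow> ereal) \<Rightarrow> complex \<Rightarrow> real" where
  "pos_part u z = real_of_ereal (max (u z) 0)"

context
  fixes u :: "complex \<Rightarrow> ereal"
  assumes sh: "subharmonic_on UNIV u"
begin

lemma ereal_pos_part: "ereal (pos_part u z) = max (u z) 0"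
proof -
  have "u z < \<infinity>" using sh by (auto simp: subharmonic_on_def)
  then show ?thesis unfolding pos_part_def by (cases "u z") (auto simp: max_def)
qed

lemma pos_part_nonneg: "0 \<le> pos_part u z"
  using ereal_pos_part[of z] by (metis ereal_less_eq(5) max.cobounded2)

lemma le_pos_part: "u z \<le> ereal (pos_part u z)"
  by (simp add: ereal_pos_part)

lemma usc_pos_part: "usc_real (pos_part u)"
  unfolding usc_real_def
proof
  fix c :: real
  show "open {z. pos_part u z < c}"
  proof (cases "c > 0")
    case False
    then have "{z. pos_part u z < c} = {}" using pos_part_nonneg by (auto simp: not_less intro: order_trans)
    then show ?thesis by simp
  next
    case True
    have "pos_part u z < c \<longleftrightarrow> u z < ereal c" for z
      using ereal_pos_part[of z] True by (metis ereal_less(2) less_ereal.simps(1) max_less_iff_conj)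
    moreover have "open {z. u z < ereal c}"
      unfolding open_subopen[of "{z. u z < ereal c}"]
    proof
      fix z assume z: "z \<in> {z. u z < ereal c}"
      then have "eventually (\<lambda>w. u w < ereal c) (at z)"
        using sh by (auto simp: subharmonic_on_def usc_on_def)
      then obtain T where "open T" "z \<in> T" "\<And>w. w \<in> T \<Longrightarrow> w \<noteq> z \<Longrightarrow> u w < ereal c"
        unfolding eventually_at_topological by auto
      then show "\<exists>T. open T \<and> z \<in> T \<and> T \<subseteq> {z. u z < ereal c}" using z by (intro exI[of _ T]) auto
    qed
    ultimately show ?thesis by simp
  qed
qed

text \<open>Where \<open>u z \<le> 0\<close> the majorant \<open>c\<close> is nonnegative; elsewhere \<open>c\<close> is also a majorant of \<open>u\<close>.\<close>

lemma submean_pos_part: "submean (pos_part u)"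
  unfolding submean_def
proof (intro allI impI)
  fix z :: complex and r :: real and c :: "real \<Rightarrow> real"
  assume r: "0 < r" and c: "set_integrable lborel {0..1} c"
    and le: "\<forall>x\<in>{0..1}. pos_part u (z + of_real r * circ x) \<le> c x"
  show "pos_part u z \<le> (LINT x:{0..1}|lborel. c x)"
  proof (cases "u z \<le> 0")
    case True
    then have "pos_part u z = 0" by (simp add: pos_part_def max_def)
    moreover have "0 \<le> (LINT x:{0..1}|lborel. c x)"
      unfolding set_lebesgue_integral_def
    proof (rule integral_nonneg_AE, rule AE_I2)
      fix x show "0 \<le> indicator {0..1} x *\<^sub>R c x"
      proof (cases "x \<in> {0..1}")
        case True
        then have "0 \<le> c x" using le order_trans[OF pos_part_nonneg] by blast
        then show ?thesis by simp
      qed simp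
    qed
    ultimately show ?thesis by simp
  next
    case False
    let ?f = "\<lambda>x. indicator {0..1} x *\<^sub>R c x"
    let ?d = "\<lambda>\<theta>. c (\<theta> / (2 * pi))"
    let ?M = "restrict_space lborel {0..2 * pi}"
    have eq: "?f (0 + 1 / (2 * pi) * \<theta>) = indicator {0..2 * pi} \<theta> *\<^sub>R ?d \<theta>" for \<theta>
      by (auto simp: indicator_def field_simps)
    have "integrable lborel ?f" using c by (simp add: set_integrable_def)
    have "integrable lborel (\<lambda>\<theta>. ?f (0 + 1 / (2 * pi) * \<theta>))"
      by (rule lborel_integrable_real_affine) (use \<open>integrable lborel ?f\<close> in simp_all)
    then have int: "integrable ?M ?d"
      unfolding eq by (subst integrable_restrict_space) auto
    have "integral\<^sup>L lborel ?f = \<bar>1 / (2 * pi)\<bar> *\<^sub>R (\<integral>\<theta>. ?f (0 + 1 / (2 * pi) * \<theta>) \<partial>lborel)"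
      by (rule lborel_integral_real_affine) simp
    also have "\<dots> = integral\<^sup>L ?M ?d / (2 * pi)"
      by (simp only: eq) (simp add: integral_restrict_space)
    finally have Ieq: "(LINT x:{0..1}|lborel. c x) = integral\<^sup>L ?M ?d / (2 * pi)"
      by (simp add: set_lebesgue_integral_def)
    have "u z \<le> ereal_integral ?M (\<lambda>\<theta>. u (z + rcis r \<theta>)) / ereal (2 * pi)"
      using sh r by (auto simp: subharmonic_on_def)
    also have "\<dots> \<le> ereal (integral\<^sup>L ?M ?d) / ereal (2 * pi)"
    proof (intro ereal_divide_right_mono ereal_integral_le int)
      fix \<theta> assume "\<theta> \<in> space ?M"
      then have \<theta>: "\<theta> \<in> {0..2 * pi}" by (simp add: space_restrict_space)
      then have "\<theta> / (2 * pi) \<in> {0..1}" by (auto simp: field_simps)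
      then have "pos_part u (z + of_real r * circ (\<theta> / (2 * pi))) \<le> ?d \<theta>" using le by blast
      then have "pos_part u (z + rcis r \<theta>) \<le> ?d \<theta>" by (simp add: circ_def rcis_def)
      then show "u (z + rcis r \<theta>) \<le> ereal (?d \<theta>)" using le_pos_part order_trans by (metis ereal_less_eq(3))
    qed simp
    finally have "u z \<le> ereal (integral\<^sup>L ?M ?d / (2 * pi))" by simp
    moreover have "u z = ereal (pos_part u z)" using False by (simp add: ereal_pos_part max_def)
    ultimately show ?thesis by (simp add: Ieq)
  qed
qed

end

section \<open>The inverse of the distribution function\<close>

context
  fixes \<nu> :: "real measure"
  assumes \<nu>: "\<nu> \<in> class_A 0 (2 * pi)"
begin

abbreviation (input) "nu_cdf \<equiv> distr_fun \<nu> 0"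
abbreviation (input) "nu_inv \<equiv> distr_inv \<nu> 0 (2 * pi)"

lemma class_A_props: "prob_space \<nu>" "sets \<nu> = sets (restrict_space borel {0..2*pi})"
    "strict_mono_on {0..2*pi} nu_cdf" "continuous_on {0..2*pi} nu_cdf" "nu_cdf ` {0..2*pi} = {0..1}"
  using \<nu> by (auto simp: class_A_def)

lemma distr_fun_inj: "inj_on nu_cdf {0..2*pi}"
  by (rule strict_mono_on_imp_inj_on[OF class_A_props(3)])

lemma distr_fun_le_iff: "x \<in> {0..2*pi} \<Longrightarrow> y \<in> {0..2*pi} \<Longrightarrow> nu_cdf x \<le> nu_cdf y \<longleftrightarrow> x \<le> y"
  using strict_mono_onD[OF class_A_props(3), of x y] strict_mono_onD[OF class_A_props(3), of y x]
  by (cases x y rule: linorder_cases) auto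

lemma distr_fun_0: "nu_cdf 0 = 0" and distr_fun_2pi: "nu_cdf (2 * pi) = 1"
proof -
  obtain x where "x \<in> {0..2*pi}" "nu_cdf x = 0" using class_A_props(5) by (metis atLeastAtMost_iff imageE order_refl zero_le_one)
  moreover have "nu_cdf 0 \<in> {0..1}" using class_A_props(5) by (metis atLeastAtMost_iff imageI order_refl pi_ge_zero zero_le_mult_iff zero_le_numeral)
  ultimately show "nu_cdf 0 = 0" using distr_fun_le_iff[of 0 x] by auto
  obtain x where "x \<in> {0..2*pi}" "nu_cdf x = 1" using class_A_props(5) by (metis atLeastAtMost_iff imageE order_refl zero_le_one)
  moreover have "nu_cdf (2*pi) \<in> {0..1}" using class_A_props(5) by (metis atLeastAtMost_iff imageI order_refl pi_ge_zero zero_le_mult_iff zero_le_numeral)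
  ultimately show "nu_cdf (2*pi) = 1" using distr_fun_le_iff[of x "2*pi"] by auto
qed

lemma distr_inv_range: "t \<in> {0..1} \<Longrightarrow> nu_inv t \<in> {0..2*pi}" and distr_fun_inv: "t \<in> {0..1} \<Longrightarrow> nu_cdf (nu_inv t) = t"
  using the_inv_into_into[OF distr_fun_inj _ subset_refl, of t] f_the_inv_into_f[OF distr_fun_inj, of t] class_A_props(5)
  by (auto simp: distr_inv_def)

lemma distr_inv_fun: "x \<in> {0..2*pi} \<Longrightarrow> nu_inv (nu_cdf x) = x"
  using distr_inv_range[of "nu_cdf x"] distr_fun_inv[of "nu_cdf x"] distr_fun_inj class_A_props(5) by (metis imageI inj_onD)

lemma distr_inv_left: "t \<le> 0 \<Longrightarrow> nu_inv t = 0" and distr_inv_right: "t \<ge> 1 \<Longrightarrow> nu_inv t = 2 * pi"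
  using distr_inv_fun[of 0] distr_inv_fun[of "2*pi"] distr_fun_0 distr_fun_2pi 
  by (cases "t = 0"; cases "t = 1"; auto simp: distr_inv_def)+

lemma distr_inv_clamp: "nu_inv t = nu_inv (max 0 (min 1 t))"
  using distr_inv_left[of t] distr_inv_right[of t] distr_inv_left[of 0] distr_inv_right[of 1] by (auto simp: max_def min_def)

lemma distr_inv_mono: "mono nu_inv"
proof (rule monoI)
  fix s t :: real assume "s \<le> t"
  define s' t' where "s' = max 0 (min 1 s)" and "t' = max 0 (min 1 t)"
  have st: "s' \<in> {0..1}" "t' \<in> {0..1}" "s' \<le> t'" using \<open>s \<le> t\<close> by (auto simp: s'_def t'_def)
  then have "nu_inv s' \<le> nu_inv t'" using distr_fun_le_iff[OF distr_inv_range distr_inv_range, of s' t'] distr_fun_inv by auto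
  then show "nu_inv s \<le> nu_inv t" using distr_inv_clamp[of s] distr_inv_clamp[of t] by (simp add: s'_def t'_def)
qed

lemma distr_inv_continuous: "continuous_on UNIV nu_inv"
proof -
  have "continuous_on (nu_cdf ` {0..2*pi}) nu_inv"
    by (rule continuous_on_inv[OF class_A_props(4)]) (auto simp: distr_inv_fun)
  then have "continuous_on {0..1} nu_inv" using class_A_props(5) by simp
  then have "continuous_on UNIV (\<lambda>t. nu_inv (max 0 (min 1 t)))"
    by (rule continuous_on_compose2) (auto intro!: continuous_intros)
  then show ?thesis by (subst (asm) distr_inv_clamp[symmetric])
qed

text \<open>The limit in the definition of the class \<open>\<A>\<close> makes the supremum smaller than 1 for some \<open>\<delta>\<close>; this
is the uniform bound that controls the conjugate function.\<close>

lemma dini_bound: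
  obtains \<delta> where "\<delta> > 0" 
    "\<And>x. (\<integral>\<^sup>+t\<in>{0<..\<delta>}. ennreal ((nu_inv (x + t) - nu_inv (x - t)) / t) \<partial>lborel) \<le> 1"
proof -
  let ?I = "\<lambda>\<delta> x. \<integral>\<^sup>+t\<in>{0<..\<delta>}. ennreal ((nu_inv (x + t) - nu_inv (x - t)) / t) \<partial>lborel"
  have "((\<lambda>\<delta>. SUP x. ?I \<delta> x) \<longlongrightarrow> 0) (at_right 0)" using \<nu> by (simp add: class_A_def)
  then have "eventually (\<lambda>\<delta>. (SUP x. ?I \<delta> x) < 1) (at_right 0)"
    by (rule order_tendstoD(2)) simp
  moreover have "eventually (\<lambda>\<delta>::real. \<delta> > 0) (at_right 0)" by (simp add: eventually_at_right_less)
  ultimately have "eventually (\<lambda>\<delta>. (SUP x. ?I \<delta> x) < 1 \<and> \<delta> > 0) (at_right 0)" by (rule eventually_conj)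
  then obtain \<delta> where \<delta>: "(SUP x. ?I \<delta> x) < 1" "\<delta> > 0"
    using eventually_happens'[of "at_right (0::real)"] by auto
  have "?I \<delta> x \<le> 1" for x
    using SUP_upper[of x UNIV "?I \<delta>"] \<delta>(1) by (auto intro: order_trans less_imp_le)
  then show ?thesis using that \<delta>(2) by blast
qed

lemma class_A_id_measurable: "(\<lambda>x. x) \<in> measurable \<nu> borel"
  using measurable_cong_sets[OF class_A_props(2) refl, of borel] measurable_restrict_space1[of "\<lambda>x. x" borel borel "{0..2*pi}"]
  by auto

lemma class_A_space: "space \<nu> = {0..2*pi}"
  using sets_eq_imp_space_eq[OF class_A_props(2)] by (simp add: space_restrict_space)

text \<open>Inverse transform sampling; \<open>\<nu>\<close> is moved to the Borel sets of the whole line in order to compare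
distribution functions.\<close>

lemma distr_distr_inv: "distr (restrict_space lborel {0..1}) borel nu_inv = distr \<nu> borel (\<lambda>x. x)"
proof -
  let ?L = "restrict_space lborel {0..1::real}"
  have m\<mu>: "nu_inv \<in> borel_measurable ?L"
    by (rule measurable_restrict_space1) (simp add: borel_measurable_continuous_onI[OF distr_inv_continuous])
  interpret L: prob_space ?L
    by (rule prob_spaceI) (simp add: space_restrict_space emeasure_restrict_space)
  interpret N: prob_space \<nu> by (rule class_A_props)
  show ?thesis
  proof (rule cdf_unique)
    show "real_distribution (distr ?L borel nu_inv)" using m\<mu> by simp
    show "real_distribution (distr \<nu> borel (\<lambda>x. x))" using class_A_id_measurable by simp
    show "cdf (distr ?L borel nu_inv) = cdf (distr \<nu> borel (\<lambda>x. x))"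
    proof
      fix t :: real
      have 1: "cdf (distr ?L borel nu_inv) t = measure lborel {x\<in>{0..1}. nu_inv x \<le> t}"
        unfolding cdf_def using m\<mu>
        by (subst measure_distr) (auto simp: space_restrict_space measure_restrict_space intro!: arg_cong[where f="measure lborel"])
      have 2: "cdf (distr \<nu> borel (\<lambda>x. x)) t = measure \<nu> {x\<in>{0..2*pi}. x \<le> t}"
        unfolding cdf_def using class_A_id_measurable
        by (subst measure_distr) (auto simp: class_A_space intro!: arg_cong[where f="measure \<nu>"])
      consider "t < 0" | "t \<in> {0..2*pi}" | "t > 2 * pi" by fastforce
      then show "cdf (distr ?L borel nu_inv) t = cdf (distr \<nu> borel (\<lambda>x. x)) t"
      proof cases
        case 1
        have "{x\<in>{0..1}. nu_inv x \<le> t} = {}" using distr_inv_range 1 by fastforce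
        moreover have "{x\<in>{0..2*pi}. x \<le> t} = {}" using 1 by auto
        ultimately show ?thesis unfolding \<open>cdf (distr ?L borel nu_inv) t = _\<close> 2 by (simp only: measure_empty)
      next
        case t: 2
        have Ft: "nu_cdf t \<in> {0..1}" using t class_A_props(5) by blast
        have "nu_inv x \<le> t \<longleftrightarrow> x \<le> nu_cdf t" if "x \<in> {0..1}" for x
          using distr_fun_le_iff[OF distr_inv_range[OF that] t] distr_fun_inv[OF that] by simp
        then have "{x\<in>{0..1}. nu_inv x \<le> t} = {0..nu_cdf t}" using Ft by auto
        moreover have "{x\<in>{0..2*pi}. x \<le> t} = {0..t}" using t by auto
        ultimately show ?thesis unfolding 1 2 using Ft by (simp add: distr_fun_def)
      next
        case t: 3
        have "{x\<in>{0..1}. nu_inv x \<le> t} = {0..1}" using distr_inv_range t by fastforce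
        moreover have "{x\<in>{0..2*pi}. x \<le> t} = space \<nu>" using t by (auto simp: class_A_space)
        ultimately show ?thesis unfolding 1 2 by (simp add: N.prob_space)
      qed
    qed
  qed
qed

lemma nn_integral_distr_inv:
  assumes [measurable]: "h \<in> borel_measurable borel"
  shows "(\<integral>\<^sup>+x\<in>{0..1}. h (nu_inv x) \<partial>lborel) = (\<integral>\<^sup>+\<theta>. h \<theta> \<partial>\<nu>)"
proof -
  have "nu_inv \<in> borel_measurable (restrict_space lborel {0..1})"
    by (rule measurable_restrict_space1) (simp add: borel_measurable_continuous_onI[OF distr_inv_continuous])
  then have "(\<integral>\<^sup>+x. h x \<partial>distr (restrict_space lborel {0..1}) borel nu_inv) = (\<integral>\<^sup>+x\<in>{0..1}. h (nu_inv x) \<partial>lborel)"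
    by (subst nn_integral_distr) (auto simp: nn_integral_restrict_space)
  moreover have "(\<integral>\<^sup>+x. h x \<partial>distr \<nu> borel (\<lambda>x. x)) = (\<integral>\<^sup>+\<theta>. h \<theta> \<partial>\<nu>)"
    using class_A_id_measurable by (subst nn_integral_distr) auto
  ultimately show ?thesis by (simp add: distr_distr_inv)
qed

end

section \<open>Integrals along rays\<close>

lemma continuous_on_rcis [continuous_intros]:
  "continuous_on S r \<Longrightarrow> continuous_on S \<alpha> \<Longrightarrow> continuous_on S (\<lambda>x. rcis (r x) (\<alpha> x))"
  unfolding rcis_def by (intro continuous_intros)

lemma borel_measurable_rcis [measurable]:
  "r \<in> borel_measurable M \<Longrightarrow> \<alpha> \<in> borel_measurable M \<Longrightarrow> (\<lambda>x. rcis (r x) (\<alpha> x)) \<in> borel_measurable M"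
  by (rule borel_measurable_continuous_Pair[of _ _ _ "\<lambda>x y. rcis x y"]) (auto intro!: continuous_intros)

text \<open>Upper semicontinuity in the form in which the reverse Fatou lemma needs it.\<close>

lemma usc_limsup_le:
  fixes w :: "'a::topological_space \<Rightarrow> real"
  assumes w: "usc_real w" and z: "zs \<longlonglongrightarrow> z"
  shows "limsup (\<lambda>n. ennreal (w (zs n))) \<le> ennreal (w z)"
  unfolding Limsup_le_iff
proof (intro allI impI)
  fix y assume "ennreal (w z) < y"
  then obtain d where d: "ennreal (w z) < d" "d < y" using dense by blast
  then obtain c where c: "0 \<le> c" "d = ennreal c" by (cases d) (auto simp: top_unique)
  have "w z < c" using d(1) c by (meson ennreal_leI not_le)
  then have "eventually (\<lambda>n. zs n \<in> {v. w v < c}) sequentially"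
    using w topological_tendstoD[OF z, of "{v. w v < c}"] by (auto simp: usc_real_def)
  then show "eventually (\<lambda>n. ennreal (w (zs n)) < y) sequentially"
  proof eventually_elim
    case (elim n)
    then have "ennreal (w (zs n)) \<le> d" unfolding c(2) by (auto intro: ennreal_leI)
    then show ?case using d(2) by simp
  qed
qed

lemma usc_bounded_above:
  fixes w :: "complex \<Rightarrow> real"
  assumes "usc_real w" "compact K" obtains C where "\<And>z. z \<in> K \<Longrightarrow> w z \<le> C"
proof (cases "K = {}")
  case False
  have "openin (top_of_set K) {z\<in>K. w z < c}" for c
    using assms(1) unfolding openin_open usc_real_def by (intro exI[of _ "{z. w z < c}"]) auto
  then obtain y where "\<And>z. z \<in> K \<Longrightarrow> w z \<le> w y"
    using usc_attains_sup[OF assms(2) False] by metis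
  then show ?thesis by (rule that)
qed (use that in auto)

definition radial_int :: "(complex \<Rightarrow> real) \<Rightarrow> real \<Rightarrow> real \<Rightarrow> real \<Rightarrow> ennreal" where
  "radial_int w a b \<alpha> = (\<integral>\<^sup>+\<sigma>\<in>{a..b}. ennreal (w (rcis \<sigma> \<alpha>)) \<partial>lborel)"

lemma radial_int_measurable [measurable]:
  assumes [measurable]: "w \<in> borel_measurable borel"
  shows "radial_int w a b \<in> borel_measurable borel"
  unfolding radial_int_def [abs_def] by measurable

lemma radial_int_bound:
  assumes C: "\<And>z. norm z \<le> b \<Longrightarrow> w z \<le> C" and ab: "0 \<le> a" "a \<le> b"
  shows "radial_int w a b \<alpha> \<le> ennreal C * ennreal (b - a)"
proof -
  have "radial_int w a b \<alpha> \<le> (\<integral>\<^sup>+\<sigma>\<in>{a..b}. ennreal C \<partial>lborel)"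
    unfolding radial_int_def using ab
    by (intro nn_integral_mono) (auto simp: indicator_def intro!: ennreal_leI C)
  then show ?thesis using ab by (simp add: nn_integral_cmult_indicator)
qed

text \<open>Reverse Fatou: the integrands are bounded on the disc of radius \<open>b\<close>, and pointwise the upper
limit is at most the value at the limit angle.\<close>

lemma radial_int_usc:
  assumes w: "usc_real w" and ab: "0 \<le> a" "a \<le> b" and \<alpha>: "\<alpha>s \<longlonglongrightarrow> \<alpha>"
  shows "limsup (\<lambda>n. radial_int w a b (\<alpha>s n)) \<le> radial_int w a b \<alpha>"
proof -
  have [measurable]: "w \<in> borel_measurable borel" by (rule usc_real_measurable[OF w])
  obtain C where C: "\<And>z. z \<in> cball 0 b \<Longrightarrow> w z \<le> C"
    using usc_bounded_above[OF w compact_cball] by metis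
  let ?f = "\<lambda>n \<sigma>. ennreal (w (rcis \<sigma> (\<alpha>s n))) * indicator {a..b} \<sigma>"
  have "limsup (\<lambda>n. integral\<^sup>N lborel (?f n)) \<le> (\<integral>\<^sup>+\<sigma>. limsup (\<lambda>n. ?f n \<sigma>) \<partial>lborel)"
  proof (rule nn_integral_limsup)
    show "AE \<sigma> in lborel. ?f n \<sigma> \<le> ennreal C * indicator {a..b} \<sigma>" for n
      using ab by (intro AE_I2) (auto simp: indicator_def intro!: ennreal_leI C)
    show "(\<integral>\<^sup>+\<sigma>. ennreal C * indicator {a..b} \<sigma> \<partial>lborel) < \<infinity>"
      using ab by (simp add: nn_integral_cmult_indicator ennreal_mult_less_top)
  qed measurable
  also have "\<dots> \<le> (\<integral>\<^sup>+\<sigma>. ennreal (w (rcis \<sigma> \<alpha>)) * indicator {a..b} \<sigma> \<partial>lborel)"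
  proof (rule nn_integral_mono)
    fix \<sigma> :: real
    have "(\<lambda>n. rcis \<sigma> (\<alpha>s n)) \<longlonglongrightarrow> rcis \<sigma> \<alpha>"
      unfolding rcis_def cis_conv_exp by (intro tendsto_intros \<alpha>)
    from usc_limsup_le[OF w this]
    show "limsup (\<lambda>n. ?f n \<sigma>) \<le> ennreal (w (rcis \<sigma> \<alpha>)) * indicator {a..b} \<sigma>"
      by (simp add: indicator_def Limsup_const)
  qed
  finally show ?thesis by (simp add: radial_int_def)
qed

text \<open>The substitution \<open>\<sigma> = s R\<close> maps \<open>[S, 2S]\<close> into \<open>[S m, 2 S M]\<close>, whatever \<open>R \<in> [m, M]\<close> is: the
dependence on the modulus is removed and only the angle remains.\<close>

lemma radial_int_dilate:
  assumes [measurable]: "w \<in> borel_measurable borel" and R: "m \<le> R" "R \<le> M" "0 < m" and S: "0 < S"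
  shows "(\<integral>\<^sup>+s\<in>{S..2*S}. ennreal (w (rcis (s * R) \<alpha>)) \<partial>lborel) \<le> ennreal (1 / m) * radial_int w (S * m) (2 * S * M) \<alpha>"
proof -
  let ?h = "\<lambda>\<sigma>. ennreal (w (rcis \<sigma> \<alpha>)) * indicator {S * R..2 * S * R} \<sigma>"
  have R0: "R > 0" using R by linarith
  have "(\<integral>\<^sup>+s\<in>{S..2*S}. ennreal (w (rcis (s * R) \<alpha>)) \<partial>lborel) = (\<integral>\<^sup>+s. ?h (0 + R * s) \<partial>lborel)"
    using R0 by (intro nn_integral_cong) (auto simp: indicator_def mult.commute)
  also have "\<dots> = ennreal (1 / R) * (ennreal \<bar>R\<bar> * (\<integral>\<^sup>+s. ?h (0 + R * s) \<partial>lborel))"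
    using R0 by (simp add: mult.assoc[symmetric] flip: ennreal_mult)
  also have "\<dots> = ennreal (1 / R) * (\<integral>\<^sup>+\<sigma>. ?h \<sigma> \<partial>lborel)"
    using R0 by (subst nn_integral_real_affine[of ?h R 0]) auto
  also have "\<dots> \<le> ennreal (1 / m) * radial_int w (S * m) (2 * S * M) \<alpha>"
  proof (intro mult_mono)
    show "ennreal (1 / R) \<le> ennreal (1 / m)" using R R0 by (intro ennreal_leI divide_left_mono) auto
    have "S * m \<le> S * R" "2 * S * R \<le> 2 * S * M" using R S by auto
    then show "(\<integral>\<^sup>+\<sigma>. ?h \<sigma> \<partial>lborel) \<le> radial_int w (S * m) (2 * S * M) \<alpha>"
      unfolding radial_int_def by (intro nn_integral_mono) (auto simp: indicator_def)
  qed auto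
  finally show ?thesis .
qed

section \<open>The growth estimate\<close>

text \<open>The Poisson majorant of \<open>w\<close> composed with \<open>z \<mapsto> s f (\<rho> z)\<close>, integrated over \<open>s \<in> [S, 2S]\<close>.
The restriction \<open>\<rho> \<ge> 3/4\<close> sends \<open>\<bar>z\<bar> \<le> 1/2\<close> into \<open>\<bar>z\<bar> \<le> 2/3\<close> after division by \<open>\<rho>\<close>, and it keeps
\<open>\<bar>f\<bar>\<close> between \<open>3/4 exp (- B)\<close> and \<open>exp B\<close> on the circle \<open>\<bar>z\<bar> = \<rho>\<close>.\<close>

lemma radial_mean_bound_inner:
  assumes w: "usc_real w" "submean w" and w0: "\<And>z. 0 \<le> w z"
    and g: "g holomorphic_on ball 0 1" and B: "\<And>z. norm z < 1 \<Longrightarrow> \<bar>Re (g z)\<bar> \<le> B"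
    and nz: "\<And>z. norm z < 1 \<Longrightarrow> deriv (\<lambda>z. z * exp (g z)) z \<noteq> 0"
    and \<rho>: "3/4 \<le> \<rho>" "\<rho> < 1" and S: "0 < S"
    and z0: "\<And>s. s \<in> {S..2*S} \<Longrightarrow> \<exists>z. norm z \<le> 1/2 \<and> z0 = of_real s * (z * exp (g z))"
  shows "ennreal (w z0) * ennreal S \<le> 5 * (ennreal (4/3 * exp B) *
     (\<integral>\<^sup>+x\<in>{0..1}. radial_int w (S * (3/4 * exp (- B))) (2 * S * exp B) (2 * pi * x + Im (g (of_real \<rho> * circ x))) \<partial>lborel))"
proof -
  have [measurable]: "w \<in> borel_measurable borel" by (rule usc_real_measurable[OF w(1)])
  let ?f = "\<lambda>z. z * exp (g z)"
  have hf: "?f holomorphic_on ball 0 1" by (intro holomorphic_intros g)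
  define R \<alpha> where "R = (\<lambda>x. \<rho> * exp (Re (g (of_real \<rho> * circ x))))" and "\<alpha> = (\<lambda>x. 2 * pi * x + Im (g (of_real \<rho> * circ x)))"
  have n\<rho>: "norm (of_real \<rho> * circ x) < 1" for x using \<rho> by (simp add: norm_mult)
  have cg: "continuous_on UNIV (\<lambda>x. g (of_real \<rho> * circ x))"
    by (rule continuous_on_compose2[OF holomorphic_on_imp_continuous_on[OF g]])
       (use n\<rho> in \<open>auto intro!: continuous_intros\<close>)
  have [measurable]: "R \<in> borel_measurable borel" "\<alpha> \<in> borel_measurable borel"
    unfolding R_def \<alpha>_def by (intro borel_measurable_continuous_onI continuous_intros cg)+
  have fR: "of_real s * ?f (of_real \<rho> * circ x) = rcis (s * R x) (\<alpha> x)" for s x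
    unfolding R_def \<alpha>_def rcis_def
    by (simp add: exp_eq_polar circ_def cis_mult[symmetric] exp_of_real mult_ac)
  have step: "ennreal (w z0) \<le> 5 * (\<integral>\<^sup>+x\<in>{0..1}. ennreal (w (rcis (s * R x) (\<alpha> x))) \<partial>lborel)"
    if s: "s \<in> {S..2*S}" for s
  proof -
    obtain z where z: "norm z \<le> 1/2" "z0 = of_real s * ?f z" using z0[OF s] by blast
    have s0: "s > 0" using s S by auto
    let ?F = "\<lambda>v. of_real s * ?f (of_real \<rho> * v)"
    have "ennreal (w (?F (z / of_real \<rho>))) \<le> 5 * (\<integral>\<^sup>+x\<in>{0..1}. ennreal (w (?F (circ x))) \<partial>lborel)"
    proof (rule poisson_majorant[OF w w0])
      have "(\<lambda>v. ?f (of_real \<rho> * v)) holomorphic_on ball 0 (1/\<rho>)"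
        by (rule holomorphic_on_compose_gen[OF _ hf, of "\<lambda>v. of_real \<rho> * v", unfolded o_def])
           (use \<rho> in \<open>auto intro!: holomorphic_intros simp: norm_mult field_simps\<close>)
      then show "?F holomorphic_on ball 0 (1/\<rho>)"
        by (rule holomorphic_on_mult[OF holomorphic_on_const])
      show "1/\<rho> > 1" using \<rho> by simp
      show "deriv ?F v \<noteq> 0" if "v \<in> ball 0 1" for v
      proof -
        have v1: "norm (of_real \<rho> * v) < 1" using that \<rho> mult_strict_mono[of \<rho> 1 "norm v" 1] by (simp add: norm_mult)
        have "(?f has_field_derivative deriv ?f (of_real \<rho> * v)) (at (of_real \<rho> * v))"
          by (rule holomorphic_derivI[OF hf open_ball]) (use v1 in simp)
        moreover have "((\<lambda>v. of_real \<rho> * v) has_field_derivative of_real \<rho>) (at v)"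
          by (auto intro!: derivative_eq_intros)
        ultimately have "((\<lambda>v. ?f (of_real \<rho> * v)) has_field_derivative deriv ?f (of_real \<rho> * v) * of_real \<rho>) (at v)"
          by (rule DERIV_chain2)
        then have "(?F has_field_derivative of_real s * (deriv ?f (of_real \<rho> * v) * of_real \<rho>)) (at v)"
          by (rule DERIV_cmult)
        then have "deriv ?F v = of_real s * (deriv ?f (of_real \<rho> * v) * of_real \<rho>)"
          by (rule DERIV_imp_deriv)
        then show ?thesis using nz[OF v1] s0 \<rho> by simp
      qed
      show "norm (z / of_real \<rho>) \<le> 2/3" using z(1) \<rho> by (simp add: norm_divide field_simps)
    qed
    then show ?thesis using z(2) \<rho> by (simp add: fR)
  qed
  have "ennreal (w z0) * ennreal S = (\<integral>\<^sup>+s\<in>{S..2*S}. ennreal (w z0) \<partial>lborel)"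
    using S by (simp add: nn_integral_cmult_indicator)
  also have "\<dots> \<le> (\<integral>\<^sup>+s. 5 * (\<integral>\<^sup>+x. ennreal (w (rcis (s * R x) (\<alpha> x))) * indicator {0..1} x * indicator {S..2*S} s \<partial>lborel) \<partial>lborel)"
  proof (rule nn_integral_mono)
    fix s :: real
    show "ennreal (w z0) * indicator {S..2*S} s \<le>
      5 * (\<integral>\<^sup>+x. ennreal (w (rcis (s * R x) (\<alpha> x))) * indicator {0..1} x * indicator {S..2*S} s \<partial>lborel)"
      using step[of s] by (simp add: indicator_def)
  qed
  also have "\<dots> = 5 * (\<integral>\<^sup>+s. (\<integral>\<^sup>+x. ennreal (w (rcis (s * R x) (\<alpha> x))) * indicator {0..1} x * indicator {S..2*S} s \<partial>lborel) \<partial>lborel)"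
    by (rule nn_integral_cmult) measurable
  also have "(\<integral>\<^sup>+s. (\<integral>\<^sup>+x. ennreal (w (rcis (s * R x) (\<alpha> x))) * indicator {0..1} x * indicator {S..2*S} s \<partial>lborel) \<partial>lborel)
     = (\<integral>\<^sup>+x. (\<integral>\<^sup>+s. ennreal (w (rcis (s * R x) (\<alpha> x))) * indicator {0..1} x * indicator {S..2*S} s \<partial>lborel) \<partial>lborel)"
    by (rule lborel_pair.Fubini'[symmetric]) measurable
  also have "\<dots> = (\<integral>\<^sup>+x. (\<integral>\<^sup>+s\<in>{S..2*S}. ennreal (w (rcis (s * R x) (\<alpha> x))) \<partial>lborel) * indicator {0..1} x \<partial>lborel)"
    by (intro nn_integral_cong) (simp add: indicator_def)
  also have "\<dots> \<le> (\<integral>\<^sup>+x. ennreal (4/3 * exp B) * (radial_int w (S * (3/4 * exp (- B))) (2 * S * exp B) (\<alpha> x) * indicator {0..1} x) \<partial>lborel)"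
  proof (rule nn_integral_mono)
    fix x :: real
    have "\<bar>Re (g (of_real \<rho> * circ x))\<bar> \<le> B" by (rule B[OF n\<rho>])
    then have e: "exp (- B) \<le> exp (Re (g (of_real \<rho> * circ x)))" "exp (Re (g (of_real \<rho> * circ x))) \<le> exp B" by auto
    have "3/4 * exp (- B) \<le> R x" unfolding R_def using e(1) \<rho> by (intro mult_mono) auto
    moreover have "R x \<le> 1 * exp B" unfolding R_def using e(2) \<rho> by (intro mult_mono) auto
    ultimately have "(\<integral>\<^sup>+s\<in>{S..2*S}. ennreal (w (rcis (s * R x) (\<alpha> x))) \<partial>lborel)
       \<le> ennreal (1 / (3/4 * exp (- B))) * radial_int w (S * (3/4 * exp (- B))) (2 * S * exp B) (\<alpha> x)"
      by (intro radial_int_dilate S) auto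
    moreover have "1 / (3/4 * exp (- B)) = 4/3 * exp B" by (simp add: exp_minus field_simps)
    ultimately have le: "(\<integral>\<^sup>+s\<in>{S..2*S}. ennreal (w (rcis (s * R x) (\<alpha> x))) \<partial>lborel)
       \<le> ennreal (4/3 * exp B) * radial_int w (S * (3/4 * exp (- B))) (2 * S * exp B) (\<alpha> x)"
      by (simp only:)
    show "(\<integral>\<^sup>+s\<in>{S..2*S}. ennreal (w (rcis (s * R x) (\<alpha> x))) \<partial>lborel) * indicator {0..1} x
      \<le> ennreal (4/3 * exp B) * (radial_int w (S * (3/4 * exp (- B))) (2 * S * exp B) (\<alpha> x) * indicator {0..1} x)"
      using le by (cases "x \<in> {0..1}") simp_all
  qed
  also have "\<dots> = ennreal (4/3 * exp B) * (\<integral>\<^sup>+x\<in>{0..1}. radial_int w (S * (3/4 * exp (- B))) (2 * S * exp B) (\<alpha> x) \<partial>lborel)"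
    by (rule nn_integral_cmult) measurable
  finally show ?thesis unfolding \<alpha>_def by (simp add: mult_left_mono)
qed

text \<open>The limit \<open>\<rho> \<rightarrow> 1\<close> in the preceding estimate.  Its right-hand side depends on \<open>\<rho>\<close> only through
the argument of \<open>f (\<rho> circ x)\<close>, which converges to \<open>\<mu> x\<close> for almost every \<open>x\<close>.\<close>

lemma radial_mean_bound:
  assumes w: "usc_real w" "submean w" and w0: "\<And>z. 0 \<le> w z"
    and g: "g holomorphic_on ball 0 1" and B: "\<And>z. norm z < 1 \<Longrightarrow> \<bar>Re (g z)\<bar> \<le> B"
    and nz: "\<And>z. norm z < 1 \<Longrightarrow> deriv (\<lambda>z. z * exp (g z)) z \<noteq> 0"
    and \<mu>: "\<And>x \<rho>. x \<in> {0<..<1} \<Longrightarrow> (\<And>n. 0 \<le> \<rho> n) \<Longrightarrow> (\<And>n. \<rho> n < 1) \<Longrightarrow> \<rho> \<longlonglongrightarrow> 1 \<Longrightarrow>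
       (\<lambda>n. 2 * pi * x + Im (g (of_real (\<rho> n) * circ x))) \<longlonglongrightarrow> \<mu> x"
    and S: "0 < S"
    and z0: "\<And>s. s \<in> {S..2*S} \<Longrightarrow> \<exists>z. norm z \<le> 1/2 \<and> z0 = of_real s * (z * exp (g z))"
  shows "ennreal (w z0) * ennreal S \<le> 5 * (ennreal (4/3 * exp B) *
     (\<integral>\<^sup>+x\<in>{0..1}. radial_int w (S * (3/4 * exp (- B))) (2 * S * exp B) (\<mu> x) \<partial>lborel))"
proof -
  have [measurable]: "w \<in> borel_measurable borel" by (rule usc_real_measurable[OF w(1)])
  define \<rho> where "\<rho> = (\<lambda>n::nat. 1 - 1 / (real n + 4))"
  have \<rho>: "3/4 \<le> \<rho> n" "\<rho> n < 1" for n by (auto simp: \<rho>_def field_simps)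
  have \<rho>0: "0 \<le> \<rho> n" for n using \<rho>(1)[of n] by linarith
  have "(\<lambda>n. 1 - inverse (real (n + 4))) \<longlonglongrightarrow> 1 - 0"
    by (intro tendsto_intros LIMSEQ_ignore_initial_segment[OF lim_inverse_n])
  then have \<rho>1: "\<rho> \<longlonglongrightarrow> 1" by (simp add: \<rho>_def inverse_eq_divide)
  define a b where "a = S * (3/4 * exp (- B))" and "b = 2 * S * exp B"
  have B0: "0 \<le> B" using B[of 0] by simp
  have ab: "0 \<le> a" "a \<le> b"
  proof -
    show "0 \<le> a" using S by (simp add: a_def)
    have "3/4 * exp (- B) \<le> 1 * 1" using B0 by (intro mult_mono) auto
    moreover have "1 \<le> 2 * exp B" using one_le_exp_iff[of B] B0 by linarith
    ultimately have "S * (3/4 * exp (- B)) \<le> S * (2 * exp B)" using S by (intro mult_left_mono) linarith+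
    then show "a \<le> b" by (simp add: a_def b_def mult_ac)
  qed
  define J where "J = (\<lambda>n x. radial_int w a b (2 * pi * x + Im (g (of_real (\<rho> n) * circ x))) * indicator {0..1} x)"
  have n\<rho>: "norm (of_real (\<rho> n) * circ x) < 1" for n x using \<rho>[of n] by (simp add: norm_mult)
  have cg: "continuous_on UNIV (\<lambda>x. g (of_real (\<rho> n) * circ x))" for n
    by (rule continuous_on_compose2[OF holomorphic_on_imp_continuous_on[OF g]])
       (use n\<rho> in \<open>auto intro!: continuous_intros\<close>)
  have [measurable]: "(\<lambda>x. 2 * pi * x + Im (g (of_real (\<rho> n) * circ x))) \<in> borel_measurable borel" for n
    by (intro borel_measurable_continuous_onI continuous_intros cg)
  have Jm [measurable]: "J n \<in> borel_measurable borel" for n unfolding J_def by measurable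
  have bound: "ennreal (w z0) * ennreal S \<le> 5 * (ennreal (4/3 * exp B) * integral\<^sup>N lborel (J n))" for n
    unfolding J_def a_def b_def
    by (rule radial_mean_bound_inner[OF w w0 g B nz \<rho> S z0])
  obtain C where C: "\<And>z. z \<in> cball 0 b \<Longrightarrow> w z \<le> C"
    using usc_bounded_above[OF w(1) compact_cball] by metis
  have "limsup (\<lambda>n. integral\<^sup>N lborel (J n)) \<le> (\<integral>\<^sup>+x. limsup (\<lambda>n. J n x) \<partial>lborel)"
  proof (rule nn_integral_limsup)
    show "AE x in lborel. J n x \<le> ennreal C * ennreal (b - a) * indicator {0..1} x" for n
      unfolding J_def using C ab by (intro AE_I2 mult_right_mono radial_int_bound) auto
    show "(\<integral>\<^sup>+x. ennreal C * ennreal (b - a) * indicator {0..1::real} x \<partial>lborel) < \<infinity>"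
      by (subst nn_integral_cmult_indicator) (auto simp: ennreal_mult_less_top)
  qed measurable
  also have "\<dots> \<le> (\<integral>\<^sup>+x. radial_int w a b (\<mu> x) * indicator {0..1} x \<partial>lborel)"
  proof (rule nn_integral_mono_AE)
    have "AE x in lborel. x \<noteq> (0::real)" "AE x in lborel. x \<noteq> (1::real)" by (rule AE_lborel_singleton)+
    then show "AE x in lborel. limsup (\<lambda>n. J n x) \<le> radial_int w a b (\<mu> x) * indicator {0..1} x"
    proof eventually_elim
      case (elim x)
      show ?case
      proof (cases "x \<in> {0..1}")
        case True
        then have x: "x \<in> {0<..<1}" using elim by auto
        have "(\<lambda>n. 2 * pi * x + Im (g (of_real (\<rho> n) * circ x))) \<longlonglongrightarrow> \<mu> x"
          by (rule \<mu>[OF x \<rho>0 \<rho>(2) \<rho>1])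
        from radial_int_usc[OF w(1) ab this] show ?thesis using True by (simp add: J_def)
      qed (simp add: J_def Limsup_const)
    qed
  qed
  finally have lim: "limsup (\<lambda>n. integral\<^sup>N lborel (J n)) \<le> (\<integral>\<^sup>+x\<in>{0..1}. radial_int w a b (\<mu> x) \<partial>lborel)" .
  \<comment> \<open>the constant is moved to the other side, so that the upper limit concerns the integrals alone\<close>
  define k where "k = 20/3 * exp B"
  have k: "k > 0" by (simp add: k_def)
  have k5: "5 * (ennreal (4/3 * exp B) * y) = ennreal k * y" for y
    by (simp add: k_def mult.assoc[symmetric] flip: ennreal_numeral ennreal_mult)
  have "ennreal (1 / k) * (ennreal (w z0) * ennreal S) \<le> integral\<^sup>N lborel (J n)" for n
  proof -
    have "ennreal (1 / k) * (ennreal (w z0) * ennreal S) \<le> ennreal (1 / k) * (ennreal k * integral\<^sup>N lborel (J n))"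
      using bound[of n] unfolding k5 by (intro mult_left_mono) auto
    also have "\<dots> = integral\<^sup>N lborel (J n)"
      using k by (simp add: mult.assoc[symmetric] flip: ennreal_mult)
    finally show ?thesis .
  qed
  then have "ennreal (1 / k) * (ennreal (w z0) * ennreal S) \<le> limsup (\<lambda>n. integral\<^sup>N lborel (J n))"
    by (intro le_Limsup) auto
  with lim have "ennreal (1 / k) * (ennreal (w z0) * ennreal S) \<le> (\<integral>\<^sup>+x\<in>{0..1}. radial_int w a b (\<mu> x) \<partial>lborel)"
    by (rule order_trans[rotated])
  then have "ennreal k * (ennreal (1 / k) * (ennreal (w z0) * ennreal S)) \<le> ennreal k * (\<integral>\<^sup>+x\<in>{0..1}. radial_int w a b (\<mu> x) \<partial>lborel)"
    by (rule mult_left_mono) simp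
  moreover have "ennreal k * (ennreal (1 / k) * (ennreal (w z0) * ennreal S)) = ennreal (w z0) * ennreal S"
    using k by (simp add: mult.assoc[symmetric] flip: ennreal_mult)
  ultimately show ?thesis unfolding k5 a_def b_def by simp
qed

text \<open>Fubini, and the transport of Lebesgue measure to \<open>\<nu>\<close>, lead back to the integrals over the circles
of radius \<open>\<sigma> \<in> [a, b]\<close>.\<close>

lemma radial_int_average_le:
  assumes \<nu>: "\<nu> \<in> class_A 0 (2 * pi)" and V: "mono_on {0..} V" and a: "0 \<le> a" "a \<le> b"
    and [measurable]: "w \<in> borel_measurable borel"
    and le: "\<And>t. t \<in> {a..b} \<Longrightarrow> (\<integral>\<^sup>+\<theta>. ennreal (w (rcis t \<theta>)) \<partial>\<nu>) \<le> ennreal (V t)"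
  shows "(\<integral>\<^sup>+x\<in>{0..1}. radial_int w a b (distr_inv \<nu> 0 (2 * pi) x) \<partial>lborel) \<le> ennreal (V b) * ennreal (b - a)"
proof -
  let ?\<mu> = "distr_inv \<nu> 0 (2 * pi)"
  have [measurable]: "?\<mu> \<in> borel_measurable borel"
    by (rule borel_measurable_continuous_onI[OF distr_inv_continuous[OF \<nu>]])
  have "(\<integral>\<^sup>+x\<in>{0..1}. radial_int w a b (?\<mu> x) \<partial>lborel)
     = (\<integral>\<^sup>+x. (\<integral>\<^sup>+\<sigma>. ennreal (w (rcis \<sigma> (?\<mu> x))) * indicator {a..b} \<sigma> * indicator {0..1} x \<partial>lborel) \<partial>lborel)"
    unfolding radial_int_def by (subst nn_integral_multc) auto
  also have "\<dots> = (\<integral>\<^sup>+\<sigma>. (\<integral>\<^sup>+x. ennreal (w (rcis \<sigma> (?\<mu> x))) * indicator {a..b} \<sigma> * indicator {0..1} x \<partial>lborel) \<partial>lborel)"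
    by (rule lborel_pair.Fubini') measurable
  also have "\<dots> \<le> (\<integral>\<^sup>+\<sigma>. ennreal (V b) * indicator {a..b} \<sigma> \<partial>lborel)"
  proof (rule nn_integral_mono)
    fix \<sigma> :: real
    show "(\<integral>\<^sup>+x. ennreal (w (rcis \<sigma> (?\<mu> x))) * indicator {a..b} \<sigma> * indicator {0..1} x \<partial>lborel)
       \<le> ennreal (V b) * indicator {a..b} \<sigma>"
    proof (cases "\<sigma> \<in> {a..b}")
      case True
      have "(\<integral>\<^sup>+x\<in>{0..1}. ennreal (w (rcis \<sigma> (?\<mu> x))) \<partial>lborel) = (\<integral>\<^sup>+\<theta>. ennreal (w (rcis \<sigma> \<theta>)) \<partial>\<nu>)"
        by (rule nn_integral_distr_inv[OF \<nu>]) measurable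
      also have "\<dots> \<le> ennreal (V \<sigma>)" by (rule le[OF True])
      also have "\<dots> \<le> ennreal (V b)"
        using V True a by (intro ennreal_leI) (auto intro: mono_onD[OF V])
      finally show ?thesis using True by simp
    qed simp
  qed
  also have "\<dots> = ennreal (V b) * ennreal (b - a)" using a by (simp add: nn_integral_cmult_indicator)
  finally show ?thesis .
qed

theorem theorem1:
  fixes \<nu> :: "real measure" and V :: "real \<Rightarrow> real" and t\<^sub>0 :: real
  assumes "\<nu> \<in> class_A 0 (2 * pi)"
    and "mono_on {0..} V"
    and "t\<^sub>0 > 0"
  shows "\<exists>c>0. \<exists>A\<ge>1. \<forall>u. subharmonic_on UNIV u \<longrightarrow>
           (\<forall>t\<ge>t\<^sub>0. enn2ereal (\<integral>\<^sup>+\<theta>. e2ennreal (max (u (rcis t \<theta>)) 0) \<partial>\<nu>) \<le> ereal (V t)) \<longrightarrow>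
           (\<forall>t\<ge>t\<^sub>0. \<forall>\<theta>\<in>{0..2 * pi}. u (rcis t \<theta>) \<le> ereal (c * V (A * t)))"
proof -
  note \<nu> = assms(1) and V = assms(2)
  let ?\<mu> = "distr_inv \<nu> 0 (2 * pi)"
  obtain \<delta> where \<delta>: "\<delta> > 0"
    "\<And>x. (\<integral>\<^sup>+t\<in>{0<..\<delta>}. ennreal ((?\<mu> (x + t) - ?\<mu> (x - t)) / t) \<partial>lborel) \<le> 1"
    by (rule dini_bound[OF \<nu>]) blast
  note \<mu>_facts = distr_inv_continuous[OF \<nu>] distr_inv_mono[OF \<nu>] distr_inv_left[OF \<nu>] distr_inv_right[OF \<nu>] \<delta>
  define g where "g = log_fun ?\<mu>"
  define B where "B = conj_bound \<delta>"
  have g: "g holomorphic_on ball 0 1"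
    unfolding g_def by (rule log_fun_holomorphic[OF \<mu>_facts])
  have B: "\<bar>Re (g z)\<bar> \<le> B" if "norm z < 1" for z
    unfolding g_def B_def by (rule log_fun_Re_bound[OF \<mu>_facts that])
  have nz: "deriv (\<lambda>z. z * exp (g z)) z \<noteq> 0" if "norm z < 1" for z
    unfolding g_def by (rule starlike_map_deriv_nz[OF \<mu>_facts that])
  have lim: "(\<lambda>n. 2 * pi * x + Im (g (of_real (\<rho> n) * circ x))) \<longlonglongrightarrow> ?\<mu> x"
    if "x \<in> {0<..<1}" "\<And>n. 0 \<le> \<rho> n" "\<And>n. \<rho> n < 1" "\<rho> \<longlonglongrightarrow> 1" for x \<rho>
    unfolding g_def by (rule angle_limit[OF \<mu>_facts that])
  have B0: "0 \<le> B" using B[of 0] by simp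
  let ?f = "\<lambda>z. z * exp (g z)"
  have hf: "?f holomorphic_on ball 0 1" by (intro holomorphic_intros g)
  have "\<not> ?f constant_on ball 0 1"
  proof
    assume "?f constant_on ball 0 1"
    then obtain c where "\<And>x. x \<in> ball 0 1 \<Longrightarrow> ?f x = c" unfolding constant_on_def by blast
    from this[of 0] this[of "1/2"] show False by simp
  qed
  then have "open (?f ` ball 0 (1/2))" by (intro open_mapping_thm[OF hf]) auto
  moreover have "0 \<in> ?f ` ball 0 (1/2)" by (rule image_eqI[of _ _ 0]) auto
  ultimately obtain d where d: "d > 0" "ball 0 d \<subseteq> ?f ` ball 0 (1/2)"
    using open_contains_ball by meson
  define m where "m = 3/4 * exp (- B)"
  \<comment> \<open>\<open>S = \<kappa> t\<close>: the first entry puts \<open>rcis t \<theta> / s\<close> into the disc of radius \<open>d\<close>, the second keeps the radii above \<open>t\<close>, where the hypothesis on \<open>u\<close> is available\<close>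
  define \<kappa> where "\<kappa> = max (2 / d) (1 / m)"
  have m0: "m > 0" by (simp add: m_def)
  have "m \<le> 1 * 1" unfolding m_def using B0 by (intro mult_mono) auto
  then have "1 \<le> 1 / m" using m0 by simp
  then have \<kappa>: "1 \<le> \<kappa>" "2 / d \<le> \<kappa>" "1 / m \<le> \<kappa>" by (auto simp: \<kappa>_def)
  define A where "A = 2 * \<kappa> * exp B"
  define c where "c = 40/3 * exp B * exp B"
  have A: "A \<ge> 1"
  proof -
    have "1 * 1 \<le> (2 * \<kappa>) * exp B" using \<kappa>(1) B0 by (intro mult_mono) auto
    then show ?thesis by (simp add: A_def)
  qed
  have c: "c > 0" by (simp add: c_def)
  have main: "u (rcis t \<theta>) \<le> ereal (c * V (A * t))"
    if sh: "subharmonic_on UNIV u"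
      and hyp: "\<And>t. t \<ge> t\<^sub>0 \<Longrightarrow> enn2ereal (\<integral>\<^sup>+\<theta>. e2ennreal (max (u (rcis t \<theta>)) 0) \<partial>\<nu>) \<le> ereal (V t)"
      and t: "t \<ge> t\<^sub>0" for u t \<theta>
  proof -
    define w where "w = pos_part u"
    define S where "S = \<kappa> * t"
    let ?z = "rcis t \<theta>"
    have t0: "t > 0" using t \<open>t\<^sub>0 > 0\<close> by simp
    have S0: "S > 0" using t0 \<kappa>(1) by (simp add: S_def)
    have w: "usc_real w" "submean w" "\<And>z. 0 \<le> w z"
      unfolding w_def using usc_pos_part[OF sh] submean_pos_part[OF sh] pos_part_nonneg[OF sh] by auto
    have wint: "(\<integral>\<^sup>+\<theta>. ennreal (w (rcis r \<theta>)) \<partial>\<nu>) \<le> ennreal (V r)" and Vnn: "0 \<le> V r" if "r \<ge> t\<^sub>0" for r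
    proof -
      have e: "e2ennreal (max (u z) 0) = ennreal (w z)" for z
        by (simp add: w_def flip: ereal_pos_part[OF sh])
      have h: "enn2ereal (\<integral>\<^sup>+\<theta>. ennreal (w (rcis r \<theta>)) \<partial>\<nu>) \<le> ereal (V r)"
        using hyp[OF that] unfolding e .
      then show "0 \<le> V r" by (metis enn2ereal_nonneg ereal_less_eq(5) order_trans)
      from e2ennreal_mono[OF h] show "(\<integral>\<^sup>+\<theta>. ennreal (w (rcis r \<theta>)) \<partial>\<nu>) \<le> ennreal (V r)" by simp
    qed
    have z0: "\<exists>z. norm z \<le> 1/2 \<and> ?z = of_real s * ?f z" if s: "s \<in> {S..2*S}" for s
    proof -
      have s0: "s > 0" using s S0 by auto
      have "2 * t \<le> d * S"
      proof -
        have "2 \<le> d * \<kappa>" using \<kappa>(2) d(1) by (simp add: field_simps)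
        then have "2 * t \<le> d * \<kappa> * t" using t0 by (intro mult_right_mono) auto
        then show ?thesis by (simp add: S_def mult_ac)
      qed
      also have "\<dots> \<le> d * s" using s d(1) by auto
      finally have "t < d * s" using t0 by linarith
      then have "?z / of_real s \<in> ball 0 d" using s0 t0 by (simp add: norm_divide field_simps)
      then obtain z where "z \<in> ball 0 (1/2)" "?z / of_real s = ?f z" using d(2) by blast
      then show ?thesis using s0 by (intro exI[of _ z]) (auto simp: field_simps)
    qed
    define a b where "a = S * m" and "b = 2 * S * exp B"
    have bA: "b = A * t" by (simp add: b_def A_def S_def)
    have at: "t \<le> a"
    proof -
      have "1 \<le> \<kappa> * m" using \<kappa>(3) m0 by (simp add: field_simps)
      then have "1 * t \<le> \<kappa> * m * t" using t0 by (intro mult_right_mono) auto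
      then show ?thesis by (simp add: a_def S_def mult_ac)
    qed
    have ab: "a \<le> b"
    proof -
      have "m \<le> 2 * exp B" using \<open>m \<le> 1 * 1\<close> one_le_exp_iff[of B] B0 by linarith
      then have "S * m \<le> S * (2 * exp B)" using S0 by (intro mult_left_mono) auto
      then show ?thesis by (simp add: a_def b_def mult_ac)
    qed
    have tb: "t\<^sub>0 \<le> b" using t at ab by linarith
    have "ennreal (w ?z) * ennreal S \<le> 5 * (ennreal (4/3 * exp B) *
        (\<integral>\<^sup>+x\<in>{0..1}. radial_int w a b (?\<mu> x) \<partial>lborel))"
      unfolding a_def b_def m_def by (rule radial_mean_bound[OF w g B nz lim S0 z0])
    also have "\<dots> \<le> 5 * (ennreal (4/3 * exp B) * (ennreal (V b) * ennreal (b - a)))"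
    proof (intro mult_left_mono radial_int_average_le[OF \<nu> V])
      show "w \<in> borel_measurable borel" by (rule usc_real_measurable[OF w(1)])
    qed (use wint at t t0 ab in auto)
    also have "\<dots> = ennreal (5 * (4/3 * exp B * (V b * (b - a))))"
    proof -
      have "0 \<le> 4/3 * exp B" by simp
      then have "ennreal (5 * (4/3 * exp B * (V b * (b - a))))
        = ennreal 5 * (ennreal (4/3 * exp B) * (ennreal (V b) * ennreal (b - a)))"
        using Vnn[OF tb] by (simp only: ennreal_mult'[of 5] ennreal_mult'[of "4/3 * exp B"] ennreal_mult'[of "V b"] zero_le_numeral)
      then show ?thesis by (simp only: ennreal_numeral)
    qed
    finally have "ennreal (w ?z * S) \<le> ennreal (5 * (4/3 * exp B * (V b * (b - a))))"
      using w(3) S0 by (simp add: ennreal_mult)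
    then have "w ?z * S \<le> 5 * (4/3 * exp B * (V b * (b - a)))"
      using Vnn[OF tb] ab by (subst (asm) ennreal_le_iff) auto
    also have "\<dots> \<le> 5 * (4/3 * exp B * (V b * b))"
      using Vnn[OF tb] at t0 by (intro mult_left_mono) auto
    also have "\<dots> = c * V b * S" by (simp add: c_def b_def mult_ac)
    finally have "w ?z \<le> c * V (A * t)" using S0 by (simp add: bA)
    then have "ereal (w ?z) \<le> ereal (c * V (A * t))" by simp
    then show ?thesis using le_pos_part[OF sh, of ?z] order_trans unfolding w_def by blast
  qed
  show ?thesis
    by (intro exI[of _ c] exI[of _ A] conjI allI impI ballI c A main) auto
qed

end
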